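(* Let $(V(u),\,u\in\mathcal T)$ be a branching random walk with reproduction point process $\aleph$ and intensity $\mu$ satisfying $\mu(\mathbb R)>1$. For $\xi\in\partial\mathcal T$ and $k\in\mathbb Z$ let $$N_\xi^k:=\sum_{n\ge0}\mathbf 1_{\{k\le V(\xi_n)<k+1\}}.$$ Then, $\mathbb P^*$-a.s., $$\lim_{n\to\infty}\frac1{n^\kappa}\sup_{\xi\in\partial\mathcal T}N_\xi^n=0$$ for all $\kappa>1$ under (H1), and for all $\kappa>2$ under (H2), where (H1) and (H2) are defined in the context.
   Context: Branching random walk: $\aleph$ is a point process on $\mathbb R$. A single particle $\varnothing$ (the root) starts at $V(\varnothing)=0$ in generation $0$. Its children, together with their positions, form the point process $\aleph=\sum_{|u|=1}\delta_{V(u)}$. Recursively, each particle $u$ of generation $n$ gives birth in generation $n+1$ to children whose positions form an independent copy of $\aleph$ shifted by $V(u)$. $\mathcal T$ is the resulting genealogical (Ulam–Harris) tree, $|u|$ is the generation of $u$ and $V(u)\in\mathbb R$ its position. Let $\mu(\mathrm dx):=\mathbb E[\aleph(\mathrm dx)]$, and assume $\mu(\mathbb R)>1$ (supercriticality; $\mu(\mathbb R)=\infty$ is not excluded). Let $\mathcal S$ be the event that $\mathcal T$ is infinite (non-extinction) and $\mathbb P^*:=\mathbb P(\cdot\mid\mathcal S)$. Put $\varphi(t):=\log\int_{\mathbb R}e^{-tx}\mu(\mathrm dx)\in(-\infty,\infty]$ for $t\in\mathbb R$. A ray $\xi$ of $\mathcal T$ is either the finite shortest path from the root to a leaf of $\mathcal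 T$, or an infinite path $\xi=(\xi_0=\varnothing,\xi_1,\xi_2,\dots)$ with $\xi_n$ the parent of $\xi_{n+1}$ for all $n$. $\partial\mathcal T$ is the set of all rays (finite or infinite); for a finite ray, sums over $n$ run only over the vertices of the ray. The integral $\int_{\mathbb R}xe^{-t^*x}\mu(\mathrm dx)$ is called well-defined if at least one of $\int_{(-\infty,0)}|x|e^{-t^*x}\mu(\mathrm dx)$, $\int_{(0,\infty)}xe^{-t^*x}\mu(\mathrm dx)$ is finite. (H1): there exists $t>0$ with $\varphi(t)=0$; $t^*$ denotes the minimal such $t$; the integral $\int_{\mathbb R}xe^{-t^*x}\mu(\mathrm dx)$ is well-defined and nonzero. (H2): there exists $t^*>0$ with $\varphi(t^* )=0$, and $\varphi(t)\in[0,\infty]$ for all $t>0$; the integral $\int_{\mathbb R}xe^{-t^*x}\mu(\mathrm dx)$ is well-defined and equal to $0$, and $\int_{\mathbb R}x^2e^{-t^*x}\mu(\mathrm dx)\in(0,\infty)$. *)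

theory Defs
  imports "HOL-Probability.Probability"
begin

text \<open>Particles carry Ulam--Harris labels, i.e. finite sequences of natural numbers (siblings are
  numbered from 0). \<open>N u \<omega>\<close> is the number, possibly infinite, of children of \<open>u\<close>, and \<open>X u i \<omega>\<close> is
  the displacement of the \<open>i\<close>-th child of \<open>u\<close> from \<open>u\<close>; it is only relevant if \<open>i < N u \<omega>\<close>.\<close>

type_synonym label = "nat list"

definition offspring :: "(label \<Rightarrow> 'w \<Rightarrow> enat) \<Rightarrow> (label \<Rightarrow> nat \<Rightarrow> 'w \<Rightarrow> real) \<Rightarrow> label \<Rightarrow> 'w \<Rightarrow> real measure"
  \<comment> \<open>the counting measure placing a unit mass at \<open>X u i \<omega>\<close> for each \<open>i < N u \<omega>\<close>\<close>
  where "offspring N X u \<omega> = distr (count_space {i. enat i < N u \<omega>}) borel (\<lambda>i. X u i \<omega>)"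

definition point_process_law :: "'w measure \<Rightarrow> ('w \<Rightarrow> real measure) \<Rightarrow> (real set \<Rightarrow> ennreal) measure"
  \<comment> \<open>the law of a point process \<open>P\<close>, i.e. the joint law of \<open>P(B)\<close>, \<open>B\<close> ranging over the Borel sets\<close>
  where "point_process_law M P =
    distr M (\<Pi>\<^sub>M B\<in>sets borel. borel) (\<lambda>\<omega>. \<lambda>B\<in>sets borel. emeasure (P \<omega>) B)"

text \<open>Independence is required for the numbered offspring, so that the numbering of the children of
  a particle carries no information on other particles; equality in law is required only for the
  point processes, so the way of numbering may vary from particle to particle. No local
  finiteness is imposed on the point processes: it holds almost surely as soon as
  \<open>\<integral>e\<^sup>-\<^sup>t\<^sup>x \<mu>(dx)\<close> is finite for some \<open>t\<close>.\<close>

locale branching_random_walk = prob_space M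
  for M :: "'w measure" +
  fixes N :: "label \<Rightarrow> 'w \<Rightarrow> enat"
    and X :: "label \<Rightarrow> nat \<Rightarrow> 'w \<Rightarrow> real"
  assumes indep_offspring:
      "indep_vars (\<lambda>_. count_space UNIV \<Otimes>\<^sub>M (\<Pi>\<^sub>M i\<in>UNIV. borel)) (\<lambda>u \<omega>. (N u \<omega>, \<lambda>i. X u i \<omega>)) UNIV"
    and identical_offspring:
      "\<And>u. point_process_law M (offspring N X u) = point_process_law M (offspring N X [])"

definition tree :: "(label \<Rightarrow> 'w \<Rightarrow> enat) \<Rightarrow> 'w \<Rightarrow> label set"
  where "tree N \<omega> = {u. \<forall>j<length u. enat (u ! j) < N (take j u) \<omega>}"

definition position :: "(label \<Rightarrow> nat \<Rightarrow> 'w \<Rightarrow> real) \<Rightarrow> 'w \<Rightarrow> label \<Rightarrow> real"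
  where "position X \<omega> u = (\<Sum>j<length u. X (take j u) (u ! j) \<omega>)"

definition survival :: "'w measure \<Rightarrow> (label \<Rightarrow> 'w \<Rightarrow> enat) \<Rightarrow> 'w set"
  where "survival M N = {\<omega> \<in> space M. infinite (tree N \<omega>)}"

definition intensity :: "'w measure \<Rightarrow> ('w \<Rightarrow> real measure) \<Rightarrow> real measure"
  where "intensity M P = measure_of UNIV (sets borel) (\<lambda>B. \<integral>\<^sup>+ \<omega>. emeasure (P \<omega>) B \<partial>M)"

definition ln_ennreal :: "ennreal \<Rightarrow> ereal"
  where "ln_ennreal a = (if a = 0 then - \<infinity> else if a = \<infinity> then \<infinity> else ereal (ln (enn2real a)))"

definition log_laplace :: "real measure \<Rightarrow> real \<Rightarrow> ereal"
  where "log_laplace \<mu> t = ln_ennreal (\<integral>\<^sup>+ x. ennreal (exp (- t * x)) \<partial>\<mu>)"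

definition tilted_neg :: "real measure \<Rightarrow> real \<Rightarrow> ennreal"
  where "tilted_neg \<mu> t = (\<integral>\<^sup>+ x\<in>{..<0}. ennreal (\<bar>x\<bar> * exp (- t * x)) \<partial>\<mu>)"

definition tilted_pos :: "real measure \<Rightarrow> real \<Rightarrow> ennreal"
  where "tilted_pos \<mu> t = (\<integral>\<^sup>+ x\<in>{0<..}. ennreal (x * exp (- t * x)) \<partial>\<mu>)"

definition mean_well_defined :: "real measure \<Rightarrow> real \<Rightarrow> bool"
  where "mean_well_defined \<mu> t \<longleftrightarrow> tilted_neg \<mu> t < \<infinity> \<or> tilted_pos \<mu> t < \<infinity>"

definition tilted_mean :: "real measure \<Rightarrow> real \<Rightarrow> ereal"
  \<comment> \<open>\<open>\<integral>x e\<^sup>-\<^sup>t\<^sup>x \<mu>(dx)\<close> as an extended real number, meaningful if \<open>mean_well_defined \<mu> t\<close>\<close>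
  where "tilted_mean \<mu> t = enn2ereal (tilted_pos \<mu> t) - enn2ereal (tilted_neg \<mu> t)"

definition H1 :: "real measure \<Rightarrow> bool"
  where "H1 \<mu> \<longleftrightarrow> (\<exists>t>0. log_laplace \<mu> t = 0 \<and> (\<forall>s>0. log_laplace \<mu> s = 0 \<longrightarrow> t \<le> s) \<and>
    mean_well_defined \<mu> t \<and> tilted_mean \<mu> t \<noteq> 0)"

definition H2 :: "real measure \<Rightarrow> bool"
  where "H2 \<mu> \<longleftrightarrow> (\<exists>t>0. log_laplace \<mu> t = 0 \<and> (\<forall>s>0. 0 \<le> log_laplace \<mu> s) \<and>
    mean_well_defined \<mu> t \<and> tilted_mean \<mu> t = 0 \<and>
    0 < (\<integral>\<^sup>+ x. ennreal (x\<^sup>2 * exp (- t * x)) \<partial>\<mu>) \<and>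
    (\<integral>\<^sup>+ x. ennreal (x\<^sup>2 * exp (- t * x)) \<partial>\<mu>) < \<infinity>)"

definition is_parent :: "label \<Rightarrow> label \<Rightarrow> bool"
  where "is_parent u v \<longleftrightarrow> (\<exists>i. v = u @ [i])"

definition leaf :: "label set \<Rightarrow> label \<Rightarrow> bool"
  where "leaf T u \<longleftrightarrow> u \<in> T \<and> \<not> (\<exists>v\<in>T. is_parent u v)"

datatype ray = Finite_Ray "label list" | Infinite_Ray "nat \<Rightarrow> label"

primrec is_ray :: "label set \<Rightarrow> ray \<Rightarrow> bool" where
  "is_ray T (Finite_Ray vs) \<longleftrightarrow>
     vs \<noteq> [] \<and> hd vs = [] \<and> set vs \<subseteq> T \<and> successively is_parent vs \<and> leaf T (last vs)"
| "is_ray T (Infinite_Ray \<xi>) \<longleftrightarrow>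
     \<xi> 0 = [] \<and> range \<xi> \<subseteq> T \<and> (\<forall>n. is_parent (\<xi> n) (\<xi> (Suc n)))"

definition rays :: "label set \<Rightarrow> ray set"
  where "rays T = {\<xi>. is_ray T \<xi>}"

primrec ray_indices :: "ray \<Rightarrow> nat set" where
  "ray_indices (Finite_Ray vs) = {..<length vs}"
| "ray_indices (Infinite_Ray \<xi>) = UNIV"

primrec ray_vertex :: "ray \<Rightarrow> nat \<Rightarrow> label" where
  "ray_vertex (Finite_Ray vs) n = vs ! n"
| "ray_vertex (Infinite_Ray \<xi>) n = \<xi> n"

definition visits :: "(label \<Rightarrow> real) \<Rightarrow> ray \<Rightarrow> int \<Rightarrow> ennreal"
  where "visits V \<xi> k = (\<Sum>n. indicator {n \<in> ray_indices \<xi>.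
    of_int k \<le> V (ray_vertex \<xi> n) \<and> V (ray_vertex \<xi> n) < of_int k + 1} n)"

end

theory Submission
  imports Defs
begin

text \<open>
  Fix \<open>t > 0\<close> with \<open>\<integral>e\<^sup>-\<^sup>t\<^sup>x \<mu>(dx) = 1\<close>. Then \<open>\<nu>(dx) = e\<^sup>-\<^sup>t\<^sup>x \<mu>(dx)\<close> is a probability law, and
  expected sums over the tree are expectations for the random walk \<open>S\<close> with step law \<open>\<nu>\<close>:
  a particle in \<open>[k, k + 1)\<close> counts with weight \<open>e\<^sup>t\<^sup>S\<close>, which is at most \<open>e\<^sup>t\<^sup>(\<^sup>k\<^sup>+\<^sup>1\<^sup>)\<close>. So if the number of
  visits of \<open>S\<close> to a short interval near \<open>k\<close> exceeds \<open>j\<close> with probability at most about \<open>(1 - d)\<^sup>j\<close>,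
  where \<open>d = d\<^sub>k\<close>, then no particle near \<open>k\<close> has more than \<open>O(k / d\<^sub>k)\<close> ancestors near \<open>k\<close>, for all
  large \<open>k\<close>. Along a ray, the last visit to an interval is made by a particle that has all the
  earlier visitors as ancestors, so a bound on these ancestors, uniform over the tree, bounds all
  the rays simultaneously.

  Under \<open>H1\<close> the walk has nonzero drift (possibly infinite) and leaves an interval for good
  with a fixed probability: \<open>d\<^sub>k\<close> is constant and there are \<open>O(k)\<close> visits. Under \<open>H2\<close> the walk is
  centred and recurrent, but here the branching random walk is almost surely
  bounded below by some random \<open>-K\<close>, so only paths of \<open>S\<close> that stay above \<open>-K\<close> matter. From
  height \<open>k\<close> a centred walk of finite variance falls below \<open>-K\<close> before it returns with
  probability at least of order \<open>1 / (k + K)\<close>: \<open>d\<^sub>k\<close> is of order \<open>1 / k\<close> and there are \<open>O(k\<^sup>2)\<close>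
  visits.

  The random walk itself never has to be constructed. The information on its visits is carried
  by a function \<open>H \<le> 1\<close> that equals 1 on the interval, is superharmonic for \<open>\<nu>\<close> in the
  region where the walk is kept alive, and whose one-step mean is at most \<open>1 - d\<close> on the interval
  (\<open>escape_function\<close>). From such an \<open>H\<close> one obtains a supermartingale indexed by the
  tree, in which every visit to the interval is rewarded by a factor \<open>1 + d / 2\<close>
  (\<open>expected_discounted_visits\<close>, based on \<open>expected_additive_functional\<close>). The
  contributions of all visits together have expectation at most 1, and summing over \<open>k\<close> with summable weights yields the almost sure bound
  \<open>AE_polynomial_visits\<close>. The functions \<open>H\<close> are built in \<open>escape_function_positive_drift\<close> as a
  return probability, and in \<open>escape_function_centred\<close> as a truncated square root.
\<close>

section \<open>Escape functions of a random walk with drift\<close>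

text \<open>
  Think of \<open>H x\<close> as an upper bound for the probability that the random walk with step law \<open>\<nu>\<close>
  started at \<open>x\<close> ever visits \<open>J\<close>, when it is killed outside \<open>D\<close>. The number \<open>d\<close> bounds from below the
  probability to escape, from a point of \<open>J\<close>, without a further visit; hence the number of visits to
  \<open>J\<close> has a geometric tail of ratio \<open>1 - d\<close>.
\<close>

definition escape_function ::
  "real measure \<Rightarrow> real set \<Rightarrow> real set \<Rightarrow> real \<Rightarrow> (real \<Rightarrow> ennreal) \<Rightarrow> bool"
  where "escape_function \<nu> D J d H \<longleftrightarrow> H \<in> borel_measurable borel \<and> (\<forall>x. H x \<le> 1) \<and>
    (\<forall>x\<in>D. (\<integral>\<^sup>+y. H (x + y) \<partial>\<nu>) \<le> H x) \<and>
    (\<forall>x\<in>J. H x = 1 \<and> (\<integral>\<^sup>+y. H (x + y) \<partial>\<nu>) \<le> ennreal (1 - d))"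

lemma escape_function_mono_rate:
  "escape_function \<nu> D J d H \<Longrightarrow> d' \<le> d \<Longrightarrow> escape_function \<nu> D J d' H"
  unfolding escape_function_def by (meson diff_left_mono ennreal_leI order_trans)

lemma escape_function_translate:
  assumes "escape_function \<nu> UNIV J d H"
  shows "escape_function \<nu> UNIV ((\<lambda>x. x + s) ` J) d (\<lambda>x. H (x - s))"
proof -
  have [measurable]: "H \<in> borel_measurable borel" using assms by (simp add: escape_function_def)
  have "(\<integral>\<^sup>+y. H (x + y - s) \<partial>\<nu>) = (\<integral>\<^sup>+y. H ((x - s) + y) \<partial>\<nu>)" for x
    by (simp add: algebra_simps)
  then show ?thesis using assms unfolding escape_function_def by auto
qed

text \<open>
  The probability that the random walk with step law \<open>\<nu>\<close> started at \<open>x\<close> enters \<open>(-\<infinity>, 0]\<close> within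
  \<open>n\<close> steps, written as a recursion on the first step so that no sample space is needed.
\<close>

primrec hit_prob :: "real measure \<Rightarrow> nat \<Rightarrow> real \<Rightarrow> ennreal" where
  "hit_prob \<nu> 0 x = (if x \<le> 0 then 1 else 0)"
| "hit_prob \<nu> (Suc n) x = (if x \<le> 0 then 1 else \<integral>\<^sup>+y. hit_prob \<nu> n (x + y) \<partial>\<nu>)"

locale real_law = prob_space \<nu> for \<nu> :: "real measure" +
  assumes sets_law [simp, measurable_cong]: "sets \<nu> = sets borel"
begin

lemma space_law [simp]: "space \<nu> = UNIV"
  using sets_eq_imp_space_eq[OF sets_law] by simp

lemma emeasure_UNIV [simp]: "emeasure \<nu> UNIV = 1"
  using emeasure_space_1 by simp

lemma prob_UNIV [simp]: "prob UNIV = 1"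
  using prob_space by simp

lemma measurable_hit_prob [measurable]: "hit_prob \<nu> n \<in> borel_measurable borel"
proof (induction n)
  case 0
  then show ?case by simp
next
  case (Suc n)
  note [measurable] = Suc
  have "(\<lambda>x. \<integral>\<^sup>+y. hit_prob \<nu> n (x + y) \<partial>\<nu>) \<in> borel_measurable borel"
    by measurable
  then show ?case by simp
qed

lemma hit_prob_nonpos [simp]: "x \<le> 0 \<Longrightarrow> hit_prob \<nu> n x = 1"
  by (cases n) auto

lemma hit_prob_le_1: "hit_prob \<nu> n x \<le> 1"
proof (induction n arbitrary: x)
  case (Suc n)
  have "(\<integral>\<^sup>+y. hit_prob \<nu> n (x + y) \<partial>\<nu>) \<le> (\<integral>\<^sup>+y. 1 \<partial>\<nu>)"
    using Suc by (intro nn_integral_mono) auto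
  then show ?case by simp
qed simp

lemma hit_prob_Suc_ge: "hit_prob \<nu> n x \<le> hit_prob \<nu> (Suc n) x"
proof (induction n arbitrary: x)
  case (Suc n)
  then show ?case
    by (cases "x \<le> 0") (auto simp del: hit_prob.simps simp add: hit_prob.simps(2)[of _ "Suc n"] hit_prob.simps(2)[of _ n] intro!: nn_integral_mono)
qed simp

lemma incseq_hit_prob: "incseq (hit_prob \<nu>)"
  by (intro incseq_SucI le_funI hit_prob_Suc_ge)

lemma hit_prob_antimono: "x \<le> y \<Longrightarrow> hit_prob \<nu> n y \<le> hit_prob \<nu> n x"
proof (induction n arbitrary: x y)
  case (Suc n)
  then show ?case
    using hit_prob_le_1[of "Suc n" y] by (auto intro!: nn_integral_mono)
qed auto

text \<open>
  Lebesgue measure is invariant under the walk, so integrating the recursion for \<open>hit_prob\<close> over all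
  starting points \<open>x > 0\<close> only moves the domain of integration from \<open>(0, \<infinity>)\<close> to \<open>(y, \<infinity>)\<close>, where \<open>y\<close>
  is the step. The difference between the two domains is \<open>(0, y]\<close> for an upward step, and for a
  downward step it is \<open>(y, 0]\<close>, where \<open>hit_prob\<close> is 1. In terms of minus
  the minimum of the walk up to time \<open>n\<close>, whose tail is \<open>hit_prob \<nu> n\<close>, this is the expectation of
  Lindley's recursion.
\<close>

lemma hit_prob_integral_identity:
  "(\<integral>\<^sup>+x. hit_prob \<nu> (Suc n) x * indicator {0<..} x \<partial>lborel)
    + (\<integral>\<^sup>+y. \<integral>\<^sup>+z. hit_prob \<nu> n z * indicator {0<..y} z \<partial>lborel \<partial>\<nu>)
   = (\<integral>\<^sup>+x. hit_prob \<nu> n x * indicator {0<..} x \<partial>lborel) + (\<integral>\<^sup>+y. ennreal (- y) \<partial>\<nu>)"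
proof -
  interpret pair_sigma_finite lborel \<nu> ..
  let ?h = "hit_prob \<nu> n"
  have "(\<integral>\<^sup>+x. hit_prob \<nu> (Suc n) x * indicator {0<..} x \<partial>lborel)
      = (\<integral>\<^sup>+x. \<integral>\<^sup>+y. ?h (x + y) * indicator {0<..} x \<partial>\<nu> \<partial>lborel)"
    by (intro nn_integral_cong) (auto simp: indicator_def)
  also have "\<dots> = (\<integral>\<^sup>+y. \<integral>\<^sup>+x. ?h (x + y) * indicator {0<..} x \<partial>lborel \<partial>\<nu>)"
    by (rule Fubini'[symmetric]) measurable
  also have "\<dots> = (\<integral>\<^sup>+y. \<integral>\<^sup>+z. ?h z * indicator {y<..} z \<partial>lborel \<partial>\<nu>)"
  proof (rule nn_integral_cong)
    fix y
    show "(\<integral>\<^sup>+x. ?h (x + y) * indicator {0<..} x \<partial>lborel) = (\<integral>\<^sup>+z. ?h z * indicator {y<..} z \<partial>lborel)"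
      by (subst (2) nn_integral_real_affine[of _ 1 y]) (auto simp: add.commute indicator_def intro!: nn_integral_cong)
  qed
  finally have *: "(\<integral>\<^sup>+x. hit_prob \<nu> (Suc n) x * indicator {0<..} x \<partial>lborel)
      = (\<integral>\<^sup>+y. \<integral>\<^sup>+z. ?h z * indicator {y<..} z \<partial>lborel \<partial>\<nu>)" .
  have "(\<integral>\<^sup>+z. ?h z * indicator {y<..} z \<partial>lborel) + (\<integral>\<^sup>+z. ?h z * indicator {0<..y} z \<partial>lborel)
      = (\<integral>\<^sup>+x. ?h x * indicator {0<..} x \<partial>lborel) + ennreal (- y)" for y
  proof -
    have "(\<integral>\<^sup>+z. ?h z * indicator {y<..} z \<partial>lborel) + (\<integral>\<^sup>+z. ?h z * indicator {0<..y} z \<partial>lborel)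
        = (\<integral>\<^sup>+z. ?h z * indicator {y<..} z + ?h z * indicator {0<..y} z \<partial>lborel)"
      by (rule nn_integral_add[symmetric]) measurable
    also have "\<dots> = (\<integral>\<^sup>+z. ?h z * indicator {0<..} z + indicator {y<..0} z \<partial>lborel)"
      by (intro nn_integral_cong) (auto simp: indicator_def)
    also have "\<dots> = (\<integral>\<^sup>+x. ?h x * indicator {0<..} x \<partial>lborel) + emeasure lborel {y<..0}"
      by (subst nn_integral_add) auto
    also have "emeasure lborel {y<..0} = ennreal (- y)"
      by (cases "y \<le> 0") (auto simp: ennreal_neg)
    finally show ?thesis .
  qed
  then have "(\<integral>\<^sup>+y. (\<integral>\<^sup>+z. ?h z * indicator {y<..} z \<partial>lborel) + (\<integral>\<^sup>+z. ?h z * indicator {0<..y} z \<partial>lborel) \<partial>\<nu>)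
      = (\<integral>\<^sup>+y. (\<integral>\<^sup>+x. ?h x * indicator {0<..} x \<partial>lborel) + ennreal (- y) \<partial>\<nu>)"
    by simp
  moreover have "(\<lambda>y. \<integral>\<^sup>+z. ?h z * indicator {y<..} z \<partial>lborel) \<in> borel_measurable \<nu>"
    "(\<lambda>y. \<integral>\<^sup>+z. ?h z * indicator {0<..y} z \<partial>lborel) \<in> borel_measurable \<nu>"
    unfolding indicator_def greaterThan_iff greaterThanAtMost_iff by measurable
  ultimately show ?thesis
    unfolding * by (simp add: nn_integral_add )
qed

text \<open>
  The integral of \<open>hit_prob \<nu> n\<close> over \<open>(0, \<infinity>)\<close> increases with \<open>n\<close>, so it may be cancelled in
  \<open>hit_prob_integral_identity\<close> as long as it is finite. If the walk returned from everywhere with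
  probability 1, the left-hand side would tend to the mean of the positive part of a step: a
  quantitative form of the fact that a recurrent walk cannot have positive drift.
\<close>

lemma overshoot_integral_le:
  assumes fin: "(\<integral>\<^sup>+y. ennreal (- y) \<partial>\<nu>) < \<infinity>"
  shows "(\<integral>\<^sup>+y. \<integral>\<^sup>+z. hit_prob \<nu> n z * indicator {0<..y} z \<partial>lborel \<partial>\<nu>) \<le> (\<integral>\<^sup>+y. ennreal (- y) \<partial>\<nu>)"
    (is "?I n \<le> ?neg")
proof -
  let ?A = "\<lambda>n. \<integral>\<^sup>+x. hit_prob \<nu> n x * indicator {0<..} x \<partial>lborel"
  have A_fin: "?A n < \<infinity>" for n
  proof (induction n)
    case 0
    have "?A 0 = (\<integral>\<^sup>+x. 0 \<partial>(lborel :: real measure))"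
      by (rule nn_integral_cong) (simp add: indicator_def)
    then show ?case by simp
  next
    case (Suc n)
    have "?A (Suc n) \<le> ?A n + ?neg"
      unfolding hit_prob_integral_identity[symmetric] by simp
    also have "\<dots> < \<infinity>" using Suc fin by simp
    finally show ?case .
  qed
  have "?A (Suc n) + ?I n = ?A n + ?neg"
    by (rule hit_prob_integral_identity)
  also have "\<dots> \<le> ?A (Suc n) + ?neg"
    by (intro add_right_mono nn_integral_mono mult_right_mono hit_prob_Suc_ge) simp
  finally show ?thesis
    using A_fin[of "Suc n"] unfolding ennreal_add_left_cancel_le by (auto simp del: hit_prob.simps)
qed

text \<open>
  The scale \<open>\<delta>\<close> of the intervals: with positive probability a single step jumps from any point of
  a closed interval of length \<open>\<delta>\<close> to a point at distance at least \<open>\<delta>\<close> beyond it.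
\<close>

lemma positive_step:
  assumes pos: "0 < (\<integral>\<^sup>+y. ennreal y \<partial>\<nu>)"
  obtains \<delta> where "0 < \<delta>" "\<delta> \<le> 1" "0 < prob {2 * \<delta>..}"
proof -
  have "\<exists>n::nat. 0 < prob {2 / real (Suc n)..}"
  proof (rule ccontr)
    assume "\<not> ?thesis"
    then have "prob {2 / real (Suc n)..} = 0" for n :: nat
      by (metis measure_nonneg order_le_less)
    then have "{2 / real (Suc n)..} \<in> null_sets \<nu>" for n :: nat
      by (auto simp: null_sets_def emeasure_eq_measure)
    then have "AE y in \<nu>. \<forall>n::nat. y \<notin> {2 / real (Suc n)..}"
      by (subst AE_all_countable) (blast intro: AE_not_in)
    then have "AE y in \<nu>. ennreal y = 0"
    proof eventually_elim
      case (elim y)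
      show ?case
      proof (rule ccontr)
        assume "ennreal y \<noteq> 0"
        then have "y / 2 > 0" by (simp add: ennreal_eq_0_iff)
        then obtain n :: nat where "inverse (real (Suc n)) < y / 2"
          using reals_Archimedean by blast
        then have "y \<in> {2 / real (Suc n)..}" by (simp add: field_simps)
        with elim show False by blast
      qed
    qed
    then have "(\<integral>\<^sup>+y. ennreal y \<partial>\<nu>) = 0"
      by (subst nn_integral_0_iff_AE) auto
    with pos show False by simp
  qed
  then obtain n :: nat where "0 < prob {2 / real (Suc n)..}" by blast
  then show ?thesis by (intro that[of "1 / real (Suc n)"]) auto
qed

text \<open>
  The return probability \<open>H\<close>, the limit of \<open>hit_prob\<close>, is superharmonic. It is not identically 1,
  since otherwise \<open>overshoot_integral_le\<close> would contradict the positive drift. Being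
  decreasing, it drops below 1 somewhere; the interval is placed just before that point, so that
  a step of size at least \<open>2 \<delta>\<close> leads from it to where \<open>H < 1\<close>. An infinite mean of the positive
  part is covered, as only the negative part has to be integrable.
\<close>

lemma escape_function_positive_drift:
  assumes drift: "(\<integral>\<^sup>+y. ennreal (- y) \<partial>\<nu>) < (\<integral>\<^sup>+y. ennreal y \<partial>\<nu>)"
  obtains x \<delta> d H where "0 < \<delta>" "\<delta> \<le> 1" "0 < d" "d \<le> 1" "escape_function \<nu> UNIV {x..x + \<delta>} d H"
proof -
  define H where "H = (\<lambda>x. SUP n. hit_prob \<nu> n x)"
  have [measurable]: "H \<in> borel_measurable borel"
    unfolding H_def by measurable
  have H_le: "H x \<le> 1" for x
    unfolding H_def by (intro SUP_least hit_prob_le_1)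
  have H_nonpos: "H x = 1" if "x \<le> 0" for x
    using that by (simp add: H_def)
  have H_antimono: "H y \<le> H x" if "x \<le> y" for x y
    unfolding H_def using hit_prob_antimono[OF that] by (intro SUP_mono) auto
  have inc: "incseq (\<lambda>n. hit_prob \<nu> n \<circ> f)" for f :: "real \<Rightarrow> real"
    using incseq_hit_prob by (auto simp: incseq_def le_fun_def)
  have PH: "(\<integral>\<^sup>+y. H (x + y) \<partial>\<nu>) \<le> H x" for x
  proof (cases "x \<le> 0")
    case True
    have "(\<integral>\<^sup>+y. H (x + y) \<partial>\<nu>) \<le> (\<integral>\<^sup>+y. 1 \<partial>\<nu>)"
      by (intro nn_integral_mono H_le)
    then show ?thesis using True by (simp add: H_nonpos)
  next
    case False
    have "(\<integral>\<^sup>+y. H (x + y) \<partial>\<nu>) = (SUP n. \<integral>\<^sup>+y. hit_prob \<nu> n (x + y) \<partial>\<nu>)"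
      unfolding H_def using inc[of "\<lambda>y. x + y"]
      by (intro nn_integral_monotone_convergence_SUP) (auto simp: o_def)
    also have "\<dots> = (SUP n. hit_prob \<nu> (Suc n) x)"
      using False by simp
    also have "\<dots> \<le> H x"
      unfolding H_def by (intro SUP_least SUP_upper) simp
    finally show ?thesis .
  qed
  have "\<exists>z>0. H z < 1"
  proof (rule ccontr)
    assume "\<not> ?thesis"
    then have H1: "H z = 1" if "z > 0" for z
      using that H_le[of z] by (metis order_le_less)
    have "(\<integral>\<^sup>+y. ennreal y \<partial>\<nu>) = (\<integral>\<^sup>+y. \<integral>\<^sup>+z. H z * indicator {0<..y} z \<partial>lborel \<partial>\<nu>)"
    proof (rule nn_integral_cong)
      fix y :: real
      have "(\<integral>\<^sup>+z. H z * indicator {0<..y} z \<partial>lborel) = (\<integral>\<^sup>+z. indicator {0<..y} z \<partial>lborel)"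
        by (intro nn_integral_cong) (auto simp: indicator_def H1)
      also have "\<dots> = ennreal y"
        by (cases "0 \<le> y") (auto simp: ennreal_neg)
      finally show "ennreal y = (\<integral>\<^sup>+z. H z * indicator {0<..y} z \<partial>lborel)" by simp
    qed
    also have "\<dots> = (\<integral>\<^sup>+y. (SUP n. \<integral>\<^sup>+z. hit_prob \<nu> n z * indicator {0<..y} z \<partial>lborel) \<partial>\<nu>)"
    proof (rule nn_integral_cong)
      fix y
      show "(\<integral>\<^sup>+z. H z * indicator {0<..y} z \<partial>lborel) = (SUP n. \<integral>\<^sup>+z. hit_prob \<nu> n z * indicator {0<..y} z \<partial>lborel)"
        using incseq_hit_prob
        by (subst nn_integral_monotone_convergence_SUP[symmetric])
          (auto simp: H_def incseq_def le_fun_def SUP_mult_right_ennreal intro!: nn_integral_cong mult_right_mono)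
    qed
    also have "\<dots> = (SUP n. \<integral>\<^sup>+y. \<integral>\<^sup>+z. hit_prob \<nu> n z * indicator {0<..y} z \<partial>lborel \<partial>\<nu>)"
    proof (rule nn_integral_monotone_convergence_SUP)
      show "incseq (\<lambda>n y. \<integral>\<^sup>+z. hit_prob \<nu> n z * indicator {0<..y} z \<partial>lborel)"
        using incseq_hit_prob by (auto simp: incseq_def le_fun_def intro!: nn_integral_mono mult_right_mono)
      show "(\<lambda>y. \<integral>\<^sup>+z. hit_prob \<nu> n z * indicator {0<..y} z \<partial>lborel) \<in> borel_measurable \<nu>" for n
        unfolding indicator_def greaterThanAtMost_iff by measurable
    qed
    also have "\<dots> \<le> (\<integral>\<^sup>+y. ennreal (- y) \<partial>\<nu>)"
      using drift by (intro SUP_least overshoot_integral_le) (auto simp: less_top[symmetric])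
    finally show False using drift by simp
  qed
  then obtain z where z: "z > 0" "H z < 1" by blast
  obtain \<delta> where \<delta>: "0 < \<delta>" "\<delta> \<le> 1" and p: "0 < prob {2 * \<delta>..}"
    using positive_step drift by (metis not_gr_zero not_less_zero)
  \<comment> \<open>The first point of the lattice of mesh \<open>\<delta>\<close> at which \<open>H\<close> is less than 1.\<close>
  define n where "n = (LEAST n. H (real n * \<delta>) < 1)"
  obtain n0 :: nat where "z / \<delta> \<le> real n0" using real_arch_simple by blast
  then have "H (real n0 * \<delta>) < 1"
    using H_antimono[of z "real n0 * \<delta>"] z \<delta> by (auto simp: field_simps)
  then have n: "H (real n * \<delta>) < 1" unfolding n_def by (rule LeastI)
  then have "n \<noteq> 0" using H_nonpos[of 0] by (metis less_irrefl mult_zero_left of_nat_0 order_refl)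
  then obtain m where m: "n = Suc m" using not0_implies_Suc by blast
  have "\<not> H (real m * \<delta>) < 1"
    using not_less_Least[of m "\<lambda>n. H (real n * \<delta>) < 1"] m by (simp add: n_def)
  then have Hm: "H (real m * \<delta>) = 1" using H_le[of "real m * \<delta>"] by (meson antisym not_less)
  define x where "x = real m * \<delta> - \<delta>"
  obtain \<rho> where \<rho>: "H (real n * \<delta>) = ennreal \<rho>" "0 \<le> \<rho>" "\<rho> < 1"
    using n by (cases "H (real n * \<delta>)" rule: ennreal_cases) (auto simp: ennreal_less_iff simp flip: ennreal_1)
  define d where "d = prob {2 * \<delta>..} * (1 - \<rho>)"
  have d: "0 < d" "d \<le> 1"
    unfolding d_def using p \<rho> prob_le_1[of "{2 * \<delta>..}"]
    by (auto intro!: mult_le_one)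
  have "H y = 1 \<and> (\<integral>\<^sup>+w. H (y + w) \<partial>\<nu>) \<le> ennreal (1 - d)" if y: "y \<in> {x..x + \<delta>}" for y
  proof
    have "H (real m * \<delta>) \<le> H y" using y by (intro H_antimono) (simp add: x_def)
    then show "H y = 1" using H_le[of y] Hm by (metis antisym)
    have "(\<integral>\<^sup>+w. H (y + w) \<partial>\<nu>) \<le> (\<integral>\<^sup>+w. ennreal (1 - (1 - \<rho>) * indicator {2 * \<delta>..} w) \<partial>\<nu>)"
    proof (rule nn_integral_mono)
      fix w
      show "H (y + w) \<le> ennreal (1 - (1 - \<rho>) * indicator {2 * \<delta>..} w)"
      proof (cases "w \<ge> 2 * \<delta>")
        case True
        then have "real n * \<delta> \<le> y + w" using y by (simp add: x_def m algebra_simps)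
        then show ?thesis using H_antimono[of "real n * \<delta>" "y + w"] True \<rho> by simp
      qed (simp add: H_le)
    qed
    also have "\<dots> = ennreal (\<integral>w. 1 - (1 - \<rho>) * indicator {2 * \<delta>..} w \<partial>\<nu>)"
    proof (rule nn_integral_eq_integral)
      show "AE w in \<nu>. 0 \<le> 1 - (1 - \<rho>) * indicator {2 * \<delta>..} w"
        using \<rho> by (auto simp: indicator_def)
    qed (auto simp: emeasure_eq_measure)
    also have "(\<integral>w. 1 - (1 - \<rho>) * indicator {2 * \<delta>..} w \<partial>\<nu>) = 1 - d"
      by (subst Bochner_Integration.integral_diff) (auto simp: d_def prob_space emeasure_eq_measure)
    finally show "(\<integral>\<^sup>+w. H (y + w) \<partial>\<nu>) \<le> ennreal (1 - d)" .
  qed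
  then have "escape_function \<nu> UNIV {x..x + \<delta>} d H"
    unfolding escape_function_def using H_le PH by simp
  with \<delta> d that show ?thesis by blast
qed

end

section \<open>Escape functions of a centred random walk above a barrier\<close>

text \<open>
  The tangent of the square root at 1, improved by the quadratic term that expresses strict
  concavity. Far from 0 the quadratic loss is given back, with a surplus that also covers the
  region \<open>s < - 2\<close>, where the tangent is negative.
\<close>

lemma sqrt_one_plus_le:
  fixes s :: real
  shows "sqrt (max 0 (1 + s)) \<le> 1 + s / 2 - s\<^sup>2 / 16 + s\<^sup>2 * indicator {s. \<bar>s\<bar> > 1} s"
proof (cases "\<bar>s\<bar> \<le> 1")
  case True
  have "1 + s \<le> (1 + s / 2 - s\<^sup>2 / 16)\<^sup>2"
  proof -
    have "(1 + s / 2 - s\<^sup>2 / 16)\<^sup>2 - (1 + s) = s\<^sup>2 * (1 / 8 - s / 16 + s\<^sup>2 / 256)"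
      by (simp add: power2_eq_square field_simps)
    moreover have "0 \<le> 1 / 8 - s / 16 + s\<^sup>2 / 256"
      using True zero_le_power2[of s] by (auto simp: abs_le_iff)
    ultimately show ?thesis by (metis diff_ge_0_iff_ge mult_nonneg_nonneg zero_le_power2)
  qed
  moreover have "0 \<le> 1 + s / 2 - s\<^sup>2 / 16"
  proof -
    have "s\<^sup>2 \<le> 1" using True by (simp add: abs_square_le_1)
    then show ?thesis using True by (simp add: abs_le_iff)
  qed
  ultimately have "sqrt (1 + s) \<le> 1 + s / 2 - s\<^sup>2 / 16" by (rule real_le_lsqrt[rotated 1]) 
  then show ?thesis using True by (auto simp: max_def indicator_def abs_le_iff)
next
  case False
  have sq: "0 \<le> s\<^sup>2" by simp
  show ?thesis
  proof (cases "s > 0")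
    case True
    have "sqrt (1 + s) \<le> 1 + s / 2"
      using True by (intro real_le_lsqrt) (auto simp: power2_eq_square field_simps)
    then show ?thesis using True False sq by (simp add: max_def, elim order_trans, simp)
  next
    case neg: False
    with False have "s < -1" by auto
    then have "0 \<le> (-s) * (-s - 1)" by (intro mult_nonneg_nonneg) auto
    then have "- s \<le> s\<^sup>2" by (simp add: power2_eq_square algebra_simps)
    then show ?thesis using \<open>s < -1\<close> by (simp add: max_def)
  qed
qed

context real_law
begin

text \<open>
  Second-order expansion: the mean of \<open>sqrt (z + y)\<close> falls short of \<open>sqrt z\<close> by the order of
  \<open>z\<^sup>-\<^sup>3\<^sup>/\<^sup>2\<close> times the variance, whereas truncating the square root at 0 costs only \<open>z\<^sup>-\<^sup>3\<^sup>/\<^sup>2\<close> times the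
  part of the variance carried by steps larger than \<open>z\<close>, which is negligible for large \<open>z\<close>.
\<close>

lemma sqrt_eventually_superharmonic:
  assumes [simp]: "integrable \<nu> (\<lambda>y. y)" "integrable \<nu> (\<lambda>y. y\<^sup>2)"
    and mean: "(\<integral>y. y \<partial>\<nu>) = 0" and var: "0 < (\<integral>y. y\<^sup>2 \<partial>\<nu>)"
  obtains a :: real where "1 \<le> a"
    "\<And>z. a \<le> z \<Longrightarrow> (\<integral>\<^sup>+y. ennreal (sqrt (max 0 (z + y))) \<partial>\<nu>) \<le> ennreal (sqrt z)"
proof -
  let ?v = "\<integral>y. y\<^sup>2 \<partial>\<nu>"
  define tail where "tail = (\<lambda>a. \<integral>y. y\<^sup>2 * indicator {y. \<bar>y\<bar> > a} y \<partial>\<nu>)"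
  have int_tail [simp]: "integrable \<nu> (\<lambda>y. y\<^sup>2 * indicator {y. \<bar>y\<bar> > a} y)" for a :: real
    by (rule Bochner_Integration.integrable_bound[OF assms(2)]) (auto simp: indicator_def)
  have "(\<lambda>n. tail (real n)) \<longlonglongrightarrow> (\<integral>y. 0 \<partial>\<nu>)"
    unfolding tail_def
  proof (rule integral_dominated_convergence[where w = "\<lambda>y. y\<^sup>2"])
    show "AE y in \<nu>. (\<lambda>n. y\<^sup>2 * indicator {y. \<bar>y\<bar> > real n} y) \<longlonglongrightarrow> 0"
    proof (rule AE_I2)
      fix y :: real
      obtain n0 where n0: "\<bar>y\<bar> \<le> real n0" using real_arch_simple by blast
      have "eventually (\<lambda>n. y\<^sup>2 * indicator {y. \<bar>y\<bar> > real n} y = 0) sequentially"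
        using eventually_ge_at_top[of n0] by eventually_elim (use n0 in \<open>auto simp: indicator_def\<close>)
      then show "(\<lambda>n. y\<^sup>2 * indicator {y. \<bar>y\<bar> > real n} y) \<longlonglongrightarrow> 0"
        by (rule tendsto_eventually)
    qed
  qed (auto simp: indicator_def)
  then have "(\<lambda>n. tail (real n)) \<longlonglongrightarrow> 0" by simp
  \<comment> \<open>The constant 16 matches the quadratic term of \<open>sqrt_one_plus_le\<close>.\<close>
  then have "eventually (\<lambda>n. tail (real n) < ?v / 16) sequentially"
    using var by (intro order_tendstoD) auto
  then obtain a' where a': "\<And>n. n \<ge> a' \<Longrightarrow> tail (real n) < ?v / 16"
    by (auto simp: eventually_sequentially)
  define a where "a = real (Suc a')"
  have a: "1 \<le> a" "tail a < ?v / 16" using a'[of "Suc a'"] by (auto simp: a_def)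
  have "(\<integral>\<^sup>+y. ennreal (sqrt (max 0 (z + y))) \<partial>\<nu>) \<le> ennreal (sqrt z)" if z: "a \<le> z" for z
  proof -
    have z0: "z > 0" using z a by simp
    define g where "g = (\<lambda>y. sqrt z * (1 + y / (2 * z) - y\<^sup>2 / (16 * z\<^sup>2) + y\<^sup>2 * indicator {y. \<bar>y\<bar> > a} y / z\<^sup>2))"
    have le: "sqrt (max 0 (z + y)) \<le> g y" for y
    proof -
      have "sqrt (max 0 (z + y)) = sqrt z * sqrt (max 0 (1 + y / z))"
      proof -
        have "max 0 (z + y) = z * max 0 (1 + y / z)"
          using z0 by (auto simp: max_def field_simps)
        then show ?thesis by (simp add: real_sqrt_mult)
      qed
      also have "\<dots> \<le> sqrt z * (1 + (y / z) / 2 - (y / z)\<^sup>2 / 16 + (y / z)\<^sup>2 * indicator {s. \<bar>s\<bar> > 1} (y / z))"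
        using z0 by (intro mult_left_mono sqrt_one_plus_le) simp
      also have "\<dots> \<le> g y"
      proof -
        have "(y / z)\<^sup>2 * indicator {s. \<bar>s\<bar> > 1} (y / z) \<le> y\<^sup>2 * indicator {y. \<bar>y\<bar> > a} y / z\<^sup>2"
          using z z0 by (auto simp: indicator_def power_divide abs_if field_simps)
        then have "1 + (y / z) / 2 - (y / z)\<^sup>2 / 16 + (y / z)\<^sup>2 * indicator {s. \<bar>s\<bar> > 1} (y / z)
          \<le> 1 + y / (2 * z) - y\<^sup>2 / (16 * z\<^sup>2) + y\<^sup>2 * indicator {y. \<bar>y\<bar> > a} y / z\<^sup>2"
          by (simp add: power_divide mult.commute)
        then show ?thesis unfolding g_def using z0 by (intro mult_left_mono) simp_all
      qed
      finally show ?thesis .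
    qed
    have g_int: "integrable \<nu> g"
      unfolding g_def by (intro integrable_mult_right Bochner_Integration.integrable_add
        Bochner_Integration.integrable_diff integrable_divide_zero) auto
    have "(\<integral>y. g y \<partial>\<nu>) = sqrt z * (1 + 0 / (2 * z) - ?v / (16 * z\<^sup>2) + tail a / z\<^sup>2)"
      unfolding g_def tail_def mean[symmetric]
      by (simp add: mean)
    also have "\<dots> \<le> sqrt z * 1"
    proof (rule mult_left_mono)
      have "tail a / z\<^sup>2 \<le> (?v / 16) / z\<^sup>2" using a by (intro divide_right_mono) auto
      then show "1 + 0 / (2 * z) - ?v / (16 * z\<^sup>2) + tail a / z\<^sup>2 \<le> 1" by simp
    qed (use z0 in simp)
    finally have "(\<integral>y. g y \<partial>\<nu>) \<le> sqrt z" by simp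
    have "(\<integral>\<^sup>+y. ennreal (sqrt (max 0 (z + y))) \<partial>\<nu>) \<le> (\<integral>\<^sup>+y. ennreal (g y) \<partial>\<nu>)"
      by (intro nn_integral_mono ennreal_leI le)
    also have "\<dots> = ennreal (\<integral>y. g y \<partial>\<nu>)"
      using g_int by (intro nn_integral_eq_integral AE_I2 order_trans[OF _ le]) auto
    also have "\<dots> \<le> ennreal (sqrt z)" by (intro ennreal_leI) fact
    finally show ?thesis .
  qed
  with a that show ?thesis by blast
qed

text \<open>
  A concave function with a kink at \<open>b\<close>: the square root of the height above \<open>- K - a\<close>, capped at its
  value at \<open>b\<close> and normalised to 1 there. Capping preserves superharmonicity. The shift by \<open>a\<close> keeps the
  argument in the range of \<open>sqrt_eventually_superharmonic\<close> as long as the walk stays above \<open>- K\<close>.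
  A step below \<open>- 2 \<delta>\<close> from the interval crosses the kink, where the normalised slope is
  \<open>1 / (2 (b + K + a))\<close>; this determines the rate.
\<close>

lemma escape_function_centred:
  assumes int: "integrable \<nu> (\<lambda>y. y)" "integrable \<nu> (\<lambda>y. y\<^sup>2)"
    and mean: "(\<integral>y. y \<partial>\<nu>) = 0" and var: "0 < (\<integral>y. y\<^sup>2 \<partial>\<nu>)"
    and step: "0 < \<delta>" "\<delta> \<le> 1" "0 < prob {..- 2 * \<delta>}"
  obtains a c where "1 \<le> a" "0 < c" "c \<le> 1"
    "\<And>K b. 0 \<le> K \<Longrightarrow> 0 \<le> b \<Longrightarrow> \<exists>H. escape_function \<nu> {- K..} {b..b + \<delta>} (c / (b + K + a)) H"
proof -
  obtain a where a: "1 \<le> a"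
    and super: "\<And>z. a \<le> z \<Longrightarrow> (\<integral>\<^sup>+y. ennreal (sqrt (max 0 (z + y))) \<partial>\<nu>) \<le> ennreal (sqrt z)"
    using sqrt_eventually_superharmonic[OF int mean var] by blast
  define p where "p = prob {..- 2 * \<delta>}"
  define c where "c = p * \<delta> / 2"
  have p: "0 < p" "p \<le> 1" using step by (auto simp: p_def)
  have "p * \<delta> \<le> 1" using p step by (intro mult_le_one) auto
  then have c: "0 < c" "c \<le> 1" using p step by (auto simp: c_def)
  have "\<exists>H. escape_function \<nu> {- K..} {b..b + \<delta>} (c / (b + K + a)) H" if K: "0 \<le> K" "0 \<le> b" for K b
  proof -
    define s where "s = b + K + a"
    have s: "1 \<le> s" using a K by (simp add: s_def)
    define H where "H = (\<lambda>x. ennreal (min 1 (sqrt (max 0 (x + K + a)) / sqrt s)))"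
    have [measurable]: "H \<in> borel_measurable borel" unfolding H_def by measurable
    have H_le: "H x \<le> 1" for x
      unfolding H_def by (rule order_trans[OF ennreal_leI[of _ 1]]) auto
    have P_le_1: "(\<integral>\<^sup>+y. H (x + y) \<partial>\<nu>) \<le> 1" for x
    proof -
      have "(\<integral>\<^sup>+y. H (x + y) \<partial>\<nu>) \<le> (\<integral>\<^sup>+y. 1 \<partial>\<nu>)" by (intro nn_integral_mono H_le)
      then show ?thesis by simp
    qed
    have PH: "(\<integral>\<^sup>+y. H (x + y) \<partial>\<nu>) \<le> H x" if x: "x \<in> {- K..}" for x
    proof -
      have "(\<integral>\<^sup>+y. H (x + y) \<partial>\<nu>) \<le> (\<integral>\<^sup>+y. ennreal (sqrt (max 0 ((x + K + a) + y))) * ennreal (1 / sqrt s) \<partial>\<nu>)"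
        unfolding H_def using s
        by (intro nn_integral_mono) (auto simp: algebra_simps divide_inverse simp flip: ennreal_mult intro!: ennreal_leI)
      also have "\<dots> = (\<integral>\<^sup>+y. ennreal (sqrt (max 0 ((x + K + a) + y))) \<partial>\<nu>) * ennreal (1 / sqrt s)"
        by (rule nn_integral_multc) measurable
      also have "\<dots> \<le> ennreal (sqrt (x + K + a)) * ennreal (1 / sqrt s)"
        using x by (intro mult_right_mono super) auto
      also have "\<dots> = ennreal (sqrt (max 0 (x + K + a)) / sqrt s)"
        using x a s by (subst ennreal_mult[symmetric]) (auto simp: max_def)
      finally show ?thesis
        using P_le_1[of x] unfolding H_def by (auto simp: min_def ennreal_1)
    qed
    have drop: "H x = 1 \<and> (\<integral>\<^sup>+y. H (x + y) \<partial>\<nu>) \<le> ennreal (1 - c / s)" if x: "x \<in> {b..b + \<delta>}" for x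
    proof
      have "s \<le> max 0 (x + K + a)" using x by (simp add: s_def le_max_iff_disj)
      then have "1 \<le> sqrt (max 0 (x + K + a)) / sqrt s"
        using s by simp
      then show "H x = 1" by (simp add: H_def min_def)
      have "H (x + y) \<le> ennreal (1 - \<delta> / (2 * s) * indicator {..- 2 * \<delta>} y)" for y
      proof (cases "y \<in> {..- 2 * \<delta>}")
        case True
        have "max 0 (x + y + K + a) \<le> s - \<delta>"
          using True x step a K by (auto simp: s_def)
        then have "sqrt (max 0 (x + y + K + a)) / sqrt s \<le> sqrt (s - \<delta>) / sqrt s"
          using s by (intro divide_right_mono real_sqrt_le_mono) auto
        also have "\<dots> = sqrt (1 - \<delta> / s)"
          using s by (simp add: real_sqrt_divide[symmetric] diff_divide_distrib)
        also have "\<dots> \<le> 1 - \<delta> / (2 * s)"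
        proof (rule real_le_lsqrt)
          have "\<delta> / s \<le> 1" using s step by (simp add: field_simps)
          then show "0 \<le> 1 - \<delta> / (2 * s)" by simp
          show "1 - \<delta> / s \<le> (1 - \<delta> / (2 * s))\<^sup>2"
            by (simp add: power2_eq_square algebra_simps)
        qed
        finally show ?thesis unfolding H_def using True by (intro ennreal_leI) simp
      qed (use H_le in simp)
      then have "(\<integral>\<^sup>+y. H (x + y) \<partial>\<nu>) \<le> (\<integral>\<^sup>+y. ennreal (1 - \<delta> / (2 * s) * indicator {..- 2 * \<delta>} y) \<partial>\<nu>)"
        by (intro nn_integral_mono)
      also have "\<dots> = ennreal (\<integral>y. 1 - \<delta> / (2 * s) * indicator {..- 2 * \<delta>} y \<partial>\<nu>)"
      proof (rule nn_integral_eq_integral)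
        have "\<delta> / (2 * s) \<le> 1" using s step by (simp add: field_simps)
        then show "AE y in \<nu>. 0 \<le> 1 - \<delta> / (2 * s) * indicator {..- 2 * \<delta>} y"
          by (auto simp: indicator_def)
      qed (auto simp: emeasure_eq_measure)
      also have "(\<integral>y. 1 - \<delta> / (2 * s) * indicator {..- 2 * \<delta>} y \<partial>\<nu>) = 1 - c / s"
        by (subst Bochner_Integration.integral_diff) (auto simp: c_def p_def emeasure_eq_measure)
      finally show "(\<integral>\<^sup>+y. H (x + y) \<partial>\<nu>) \<le> ennreal (1 - c / s)" .
    qed
    have "escape_function \<nu> {- K..} {b..b + \<delta>} (c / s) H"
      unfolding escape_function_def using H_le PH drop by auto
    then show ?thesis unfolding s_def by blast
  qed
  with a c that show ?thesis by blast
qed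

end

section \<open>Escape functions in terms of the first two moments\<close>

text \<open>
  Reduces negative drift to positive drift.
\<close>

lemma escape_function_reflect:
  assumes law: "real_law \<nu>" and esc: "escape_function (distr \<nu> borel uminus) UNIV J d H"
  shows "escape_function \<nu> UNIV (uminus ` J) d (\<lambda>x. H (- x))"
proof -
  interpret real_law \<nu> by fact
  have [measurable]: "H \<in> borel_measurable borel" using esc by (simp add: escape_function_def)
  have "(\<integral>\<^sup>+y. H (- (x + y)) \<partial>\<nu>) = (\<integral>\<^sup>+y. H (- x + y) \<partial>distr \<nu> borel uminus)" for x
    by (subst nn_integral_distr) auto
  moreover have "(\<integral>\<^sup>+y. H (x + y) \<partial>distr \<nu> borel uminus) \<le> H x" for x
    using esc by (simp add: escape_function_def)
  ultimately have super: "(\<integral>\<^sup>+y. H (- (x + y)) \<partial>\<nu>) \<le> H (- x)" for x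
    by metis
  have "(\<integral>\<^sup>+y. H (- (- x + y)) \<partial>\<nu>) \<le> ennreal (1 - d)" if "x \<in> J" for x
  proof -
    have "(\<integral>\<^sup>+y. H (- (- x + y)) \<partial>\<nu>) = (\<integral>\<^sup>+y. H (x + y) \<partial>distr \<nu> borel uminus)"
      by (subst nn_integral_distr) auto
    with esc that show ?thesis by (simp only: escape_function_def)
  qed
  note drop = this
  have bounds: "H x \<le> 1" "x \<in> J \<Longrightarrow> H x = 1" for x
    using esc by (auto simp: escape_function_def)
  show ?thesis
    unfolding escape_function_def
  proof (intro conjI ballI allI)
    show "(\<lambda>x. H (- x)) \<in> borel_measurable borel" by measurable
  next
    fix x assume "x \<in> uminus ` J"
    then obtain z where z: "z \<in> J" "x = - z" by blast
    show "H (- x) = 1" using bounds(2)[OF z(1)] z(2) by simp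
    show "(\<integral>\<^sup>+y. H (- (x + y)) \<partial>\<nu>) \<le> ennreal (1 - d)" using drop[OF z(1)] z(2) by simp
  qed (rule bounds super)+
qed

context real_law
begin

lemma real_law_reflect: "real_law (distr \<nu> borel uminus)"
proof (rule real_law.intro)
  show "prob_space (distr \<nu> borel uminus)" by (rule prob_space_distr) measurable
  show "real_law_axioms (distr \<nu> borel uminus)" by (rule real_law_axioms.intro) simp
qed

lemma nn_integral_reflect:
  "f \<in> borel_measurable borel \<Longrightarrow> (\<integral>\<^sup>+y. f y \<partial>distr \<nu> borel uminus) = (\<integral>\<^sup>+y. f (- y) \<partial>\<nu>)"
  by (subst nn_integral_distr) auto

lemma escape_function_drift:
  assumes drift: "(\<integral>\<^sup>+y. ennreal (- y) \<partial>\<nu>) \<noteq> (\<integral>\<^sup>+y. ennreal y \<partial>\<nu>)"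
  obtains \<delta> d where "0 < \<delta>" "\<delta> \<le> 1" "0 < d" "d \<le> 1"
    "\<And>b. \<exists>H. escape_function \<nu> UNIV {b..b + \<delta>} d H"
proof -
  have "\<exists>x \<delta> d H. 0 < \<delta> \<and> \<delta> \<le> 1 \<and> 0 < d \<and> d \<le> 1 \<and> escape_function \<nu> UNIV {x..x + \<delta>} d H"
  proof (cases "(\<integral>\<^sup>+y. ennreal (- y) \<partial>\<nu>) < (\<integral>\<^sup>+y. ennreal y \<partial>\<nu>)")
    case True
    then show ?thesis using escape_function_positive_drift by metis
  next
    case False
    interpret R: real_law "distr \<nu> borel uminus" by (rule real_law_reflect)
    have "(\<integral>\<^sup>+y. ennreal (- y) \<partial>distr \<nu> borel uminus) < (\<integral>\<^sup>+y. ennreal y \<partial>distr \<nu> borel uminus)"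
      using False drift by (simp add: nn_integral_reflect)
    then obtain x \<delta> d H where *: "0 < \<delta>" "\<delta> \<le> 1" "0 < d" "d \<le> 1"
      "escape_function (distr \<nu> borel uminus) UNIV {x..x + \<delta>} d H"
      using R.escape_function_positive_drift by metis
    have "escape_function \<nu> UNIV {- (x + \<delta>)..- (x + \<delta>) + \<delta>} d (\<lambda>x. H (- x))"
      using escape_function_reflect[OF real_law_axioms *(5)] by simp
    with * show ?thesis by blast
  qed
  then obtain x \<delta> d H where *: "0 < \<delta>" "\<delta> \<le> 1" "0 < d" "d \<le> 1" and H: "escape_function \<nu> UNIV {x..x + \<delta>} d H"
    by blast
  have "\<exists>H. escape_function \<nu> UNIV {b..b + \<delta>} d H" for b
  proof -
    have "(\<lambda>y. y + (b - x)) ` {x..x + \<delta>} = {b..b + \<delta>}"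
      by (simp add: image_add_atLeastAtMost'[of "b - x"])
    with escape_function_translate[OF H, of "b - x"] show ?thesis by metis
  qed
  with * that show ?thesis by blast
qed

lemma escape_function_no_drift:
  assumes mean: "(\<integral>\<^sup>+y. ennreal (- y) \<partial>\<nu>) = (\<integral>\<^sup>+y. ennreal y \<partial>\<nu>)" "(\<integral>\<^sup>+y. ennreal y \<partial>\<nu>) < \<infinity>"
    and var: "0 < (\<integral>\<^sup>+y. ennreal (y\<^sup>2) \<partial>\<nu>)" "(\<integral>\<^sup>+y. ennreal (y\<^sup>2) \<partial>\<nu>) < \<infinity>"
  obtains \<delta> a c where "0 < \<delta>" "\<delta> \<le> 1" "1 \<le> a" "0 < c" "c \<le> 1"
    "\<And>K b. 0 \<le> K \<Longrightarrow> 0 \<le> b \<Longrightarrow> \<exists>H. escape_function \<nu> {- K..} {b..b + \<delta>} (c / (b + K + a)) H"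
proof -
  have "(\<integral>\<^sup>+y. ennreal (norm y) \<partial>\<nu>) = (\<integral>\<^sup>+y. ennreal y + ennreal (- y) \<partial>\<nu>)"
    by (intro nn_integral_cong) (auto simp: abs_if ennreal_neg)
  also have "\<dots> = (\<integral>\<^sup>+y. ennreal y \<partial>\<nu>) + (\<integral>\<^sup>+y. ennreal (- y) \<partial>\<nu>)"
    by (rule nn_integral_add) auto
  also have "\<dots> < \<infinity>" using mean by simp
  finally have int1: "integrable \<nu> (\<lambda>y. y)" by (intro integrableI_bounded) auto
  have int2: "integrable \<nu> (\<lambda>y. y\<^sup>2)" using var(2) by (intro integrableI_bounded) auto
  have mean0: "(\<integral>y. y \<partial>\<nu>) = 0"
    using mean(1) by (simp add: real_lebesgue_integral_def[OF int1])
  have "ennreal (\<integral>y. y\<^sup>2 \<partial>\<nu>) = (\<integral>\<^sup>+y. ennreal (y\<^sup>2) \<partial>\<nu>)"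
    by (rule nn_integral_eq_integral[symmetric]) (use int2 in auto)
  then have var0: "0 < (\<integral>y. y\<^sup>2 \<partial>\<nu>)" using var(1) by (metis ennreal_less_zero_iff)
  interpret R: real_law "distr \<nu> borel uminus" by (rule real_law_reflect)
  have "0 < (\<integral>\<^sup>+y. ennreal y \<partial>distr \<nu> borel uminus)"
  proof (rule ccontr)
    assume "\<not> ?thesis"
    then have "(\<integral>\<^sup>+y. ennreal (- y) \<partial>\<nu>) = 0" "(\<integral>\<^sup>+y. ennreal y \<partial>\<nu>) = 0"
      using mean by (simp_all add: nn_integral_reflect)
    then have "AE y in \<nu>. ennreal (- y) = 0" "AE y in \<nu>. ennreal y = 0"
      by (simp_all add: nn_integral_0_iff_AE)
    then have "AE y in \<nu>. ennreal (y\<^sup>2) = 0"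
      by eventually_elim (simp add: ennreal_eq_0_iff)
    then have "(\<integral>\<^sup>+y. ennreal (y\<^sup>2) \<partial>\<nu>) = 0"
      by (subst nn_integral_0_iff_AE) auto
    with var show False by simp
  qed
  then obtain \<delta> where \<delta>: "0 < \<delta>" "\<delta> \<le> 1" "0 < measure (distr \<nu> borel uminus) {2 * \<delta>..}"
    using R.positive_step by metis
  have "uminus -` {2 * \<delta>..} = {..- 2 * \<delta>}" by auto
  then have "0 < prob {..- 2 * \<delta>}"
    using \<delta>(3) by (simp add: measure_distr)
  with escape_function_centred[OF int1 int2 mean0 var0 \<delta>(1,2)] that \<delta> show ?thesis by metis
qed

end

section \<open>First moments of the offspring\<close>

context branching_random_walk
begin

lemma measurable_NX [measurable]:
  "(\<lambda>\<omega>. (N u \<omega>, \<lambda>i. X u i \<omega>)) \<in> M \<rightarrow>\<^sub>M count_space UNIV \<Otimes>\<^sub>M (\<Pi>\<^sub>M i\<in>UNIV. borel)"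
  using indep_offspring by (simp add: indep_vars_def)

lemma measurable_N [measurable]: "N u \<in> M \<rightarrow>\<^sub>M count_space UNIV"
  using measurable_compose[OF measurable_NX[of u] measurable_fst] by simp

lemma measurable_X [measurable]: "X u i \<in> borel_measurable M"
proof -
  have "(\<lambda>\<omega>. \<lambda>i. X u i \<omega>) \<in> M \<rightarrow>\<^sub>M (\<Pi>\<^sub>M i\<in>UNIV. borel)"
    using measurable_compose[OF measurable_NX[of u] measurable_snd] by simp
  from measurable_compose[OF this measurable_component_singleton[of i]] show ?thesis by simp
qed

lemma nn_integral_offspring:
  assumes [measurable]: "f \<in> borel_measurable borel"
  shows "(\<integral>\<^sup>+y. f y \<partial>offspring N X u \<omega>) = (\<Sum>i. indicator {i. enat i < N u \<omega>} i * f (X u i \<omega>))"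
proof -
  have "(\<integral>\<^sup>+y. f y \<partial>offspring N X u \<omega>) = (\<integral>\<^sup>+i. f (X u i \<omega>) \<partial>count_space {i. enat i < N u \<omega>})"
    unfolding offspring_def by (subst nn_integral_distr) auto
  also have "\<dots> = (\<integral>\<^sup>+i. indicator {i. enat i < N u \<omega>} i * f (X u i \<omega>) \<partial>count_space UNIV)"
    by (subst nn_integral_count_space_indicator) (auto simp: mult.commute)
  finally show ?thesis by (simp add: nn_integral_count_space_nat)
qed

lemma sets_offspring [simp]: "sets (offspring N X u \<omega>) = sets borel"
  by (simp add: offspring_def)

lemma measurable_nn_integral_offspring [measurable]:
  assumes [measurable]: "f \<in> borel_measurable borel"
  shows "(\<lambda>\<omega>. \<integral>\<^sup>+y. f y \<partial>offspring N X u \<omega>) \<in> borel_measurable M"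
  unfolding nn_integral_offspring[OF assms] indicator_def by measurable

lemma measurable_emeasure_offspring [measurable]:
  assumes "B \<in> sets borel"
  shows "(\<lambda>\<omega>. emeasure (offspring N X u \<omega>) B) \<in> borel_measurable M"
  using measurable_nn_integral_offspring[of "indicator B" u] assms by simp

lemma sets_intensity [simp]: "sets (intensity M P) = sets borel"
  unfolding intensity_def
  by (metis sets.sets_measure_of_eq space_borel)

lemma emeasure_intensity:
  assumes B: "B \<in> sets borel"
  shows "emeasure (intensity M (offspring N X u)) B = (\<integral>\<^sup>+\<omega>. emeasure (offspring N X u \<omega>) B \<partial>M)"
proof (rule emeasure_measure_of[OF intensity_def])
  show "countably_additive (sets (intensity M (offspring N X u))) (\<lambda>B. \<integral>\<^sup>+\<omega>. emeasure (offspring N X u \<omega>) B \<partial>M)"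
  proof (rule countably_additiveI, goal_cases)
    case (1 A)
    have [measurable]: "A i \<in> sets borel" for i using 1 by auto
    have "(\<Sum>i. \<integral>\<^sup>+\<omega>. emeasure (offspring N X u \<omega>) (A i) \<partial>M)
      = (\<integral>\<^sup>+\<omega>. (\<Sum>i. emeasure (offspring N X u \<omega>) (A i)) \<partial>M)"
      by (rule nn_integral_suminf[symmetric]) measurable
    also have "\<dots> = (\<integral>\<^sup>+\<omega>. emeasure (offspring N X u \<omega>) (\<Union>i. A i) \<partial>M)"
      by (intro nn_integral_cong suminf_emeasure) (use 1 in auto)
    finally show ?case .
  qed
qed (use B in \<open>auto simp: positive_def\<close>)

text \<open>
  The intensity depends on the law of the point process alone; the numbering of the children, which
  may have a different law for each particle, does not enter.
\<close>

lemma emeasure_offspring_identical: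
  assumes B: "B \<in> sets borel"
  shows "(\<integral>\<^sup>+\<omega>. emeasure (offspring N X u \<omega>) B \<partial>M) = (\<integral>\<^sup>+\<omega>. emeasure (offspring N X [] \<omega>) B \<partial>M)"
proof -
  have "(\<integral>\<^sup>+\<omega>. emeasure (offspring N X v \<omega>) B \<partial>M) = (\<integral>\<^sup>+m. m B \<partial>point_process_law M (offspring N X v))" for v
  proof -
    have "(\<lambda>\<omega>. \<lambda>B\<in>sets borel. emeasure (offspring N X v \<omega>) B) \<in> M \<rightarrow>\<^sub>M (\<Pi>\<^sub>M B\<in>sets borel. borel)"
      by (rule measurable_restrict) (rule measurable_emeasure_offspring)
    then show ?thesis
      unfolding point_process_law_def using B
      by (subst nn_integral_distr) (auto intro!: measurable_component_singleton)
  qed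
  then show ?thesis using identical_offspring[of u] by simp
qed

lemma measurable_offspring_iff [simp]:
  "f \<in> borel_measurable (offspring N X u \<omega>) \<longleftrightarrow> f \<in> borel_measurable borel"
  using measurable_cong_sets[OF sets_offspring refl] by blast

lemma measurable_intensity_iff [simp]:
  "f \<in> borel_measurable (intensity M P) \<longleftrightarrow> f \<in> borel_measurable borel"
  using measurable_cong_sets[OF sets_intensity refl] by blast

lemma nn_integral_intensity:
  assumes "f \<in> borel_measurable borel"
  shows "(\<integral>\<^sup>+\<omega>. \<integral>\<^sup>+y. f y \<partial>offspring N X u \<omega> \<partial>M) = (\<integral>\<^sup>+y. f y \<partial>intensity M (offspring N X []))"
  using assms
proof (induction rule: borel_measurable_induct)
  case (cong f g)
  then have "f = g" by (simp add: fun_eq_iff)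
  with cong show ?case by simp
next
  case (set A)
  then have "(\<integral>\<^sup>+\<omega>. emeasure (offspring N X u \<omega>) A \<partial>M) = emeasure (intensity M (offspring N X [])) A"
    unfolding emeasure_intensity[OF set] by (rule emeasure_offspring_identical)
  with set show ?case by (simp add: nn_integral_indicator)
next
  case (mult f c)
  note [measurable] = mult(2)
  have "(\<integral>\<^sup>+\<omega>. \<integral>\<^sup>+y. c * f y \<partial>offspring N X u \<omega> \<partial>M) = c * (\<integral>\<^sup>+\<omega>. \<integral>\<^sup>+y. f y \<partial>offspring N X u \<omega> \<partial>M)"
    using mult(2) by (subst nn_integral_cmult[symmetric]) (auto intro!: nn_integral_cong nn_integral_cmult)
  also have "\<dots> = (\<integral>\<^sup>+y. c * f y \<partial>intensity M (offspring N X []))"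
    unfolding mult(4) using mult(2) by (intro nn_integral_cmult[symmetric]) simp
  finally show ?case .
next
  case (add f g)
  have [measurable]: "f \<in> borel_measurable borel" "g \<in> borel_measurable borel"
    using add by auto
  have "(\<integral>\<^sup>+\<omega>. \<integral>\<^sup>+y. g y + f y \<partial>offspring N X u \<omega> \<partial>M)
      = (\<integral>\<^sup>+\<omega>. \<integral>\<^sup>+y. g y \<partial>offspring N X u \<omega> \<partial>M) + (\<integral>\<^sup>+\<omega>. \<integral>\<^sup>+y. f y \<partial>offspring N X u \<omega> \<partial>M)"
    by (subst nn_integral_add[symmetric]) (auto intro!: nn_integral_cong nn_integral_add)
  also have "\<dots> = (\<integral>\<^sup>+y. g y \<partial>intensity M (offspring N X [])) + (\<integral>\<^sup>+y. f y \<partial>intensity M (offspring N X []))"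
    using add by simp
  also have "\<dots> = (\<integral>\<^sup>+y. g y + f y \<partial>intensity M (offspring N X []))"
    by (intro nn_integral_add[symmetric]) simp_all
  finally show ?case .
next
  case (seq F)
  note [measurable] = seq(1)
  have inc: "incseq F" using seq by auto
  have "(\<integral>\<^sup>+y. Sup (range F) y \<partial>offspring N X u \<omega>) = (SUP i. \<integral>\<^sup>+y. F i y \<partial>offspring N X u \<omega>)" for \<omega>
    unfolding SUP_apply using seq
    by (intro nn_integral_monotone_convergence_SUP) auto
  then have "(\<integral>\<^sup>+\<omega>. \<integral>\<^sup>+y. Sup (range F) y \<partial>offspring N X u \<omega> \<partial>M) = (\<integral>\<^sup>+\<omega>. (SUP i. \<integral>\<^sup>+y. F i y \<partial>offspring N X u \<omega>) \<partial>M)"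
    by simp
  also have "\<dots> = (SUP i. \<integral>\<^sup>+\<omega>. \<integral>\<^sup>+y. F i y \<partial>offspring N X u \<omega> \<partial>M)"
    using inc by (intro nn_integral_monotone_convergence_SUP)
      (auto simp: incseq_def le_fun_def intro!: nn_integral_mono)
  also have "\<dots> = (SUP i. \<integral>\<^sup>+y. F i y \<partial>intensity M (offspring N X []))"
    using seq by simp
  also have "\<dots> = (\<integral>\<^sup>+y. Sup (range F) y \<partial>intensity M (offspring N X []))"
    unfolding SUP_apply using seq
    by (intro nn_integral_monotone_convergence_SUP[symmetric]) auto
  finally show ?case .
qed

text \<open>
  The intensity need not be \<open>\<sigma>\<close>-finite, so Fubini's theorem is applied to the probability space
  instead: the integral is the expectation of a sum over the children of the root.
\<close>

lemma measurable_nn_integral_intensity: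
  assumes [measurable]: "h \<in> borel_measurable borel"
  shows "(\<lambda>x. \<integral>\<^sup>+y. h (x + y) \<partial>intensity M (offspring N X [])) \<in> borel_measurable borel"
proof -
  have "(\<integral>\<^sup>+y. h (x + y) \<partial>intensity M (offspring N X []))
      = (\<integral>\<^sup>+\<omega>. (\<Sum>i. indicator {i. enat i < N [] \<omega>} i * h (x + X [] i \<omega>)) \<partial>M)" for x
    by (subst nn_integral_intensity[of _ "[]", symmetric]) (auto simp: nn_integral_offspring)
  then show ?thesis
    unfolding indicator_def by simp
qed

end

section \<open>Additive functionals along the tree\<close>

text \<open>
  A multiplicative functional of the ancestral line. The particle itself does not contribute, so
  \<open>path_weight q V u\<close> is determined by the offspring of strict ancestors of \<open>u\<close>.
\<close>

definition path_weight :: "(real \<Rightarrow> ennreal) \<Rightarrow> (label \<Rightarrow> real) \<Rightarrow> label \<Rightarrow> ennreal"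
  where "path_weight q V u = (\<Prod>j<length u. q (V (take j u)))"

lemma path_weight_Nil [simp]: "path_weight q V [] = 1"
  by (simp add: path_weight_def)

lemma path_weight_snoc [simp]: "path_weight q V (u @ [i]) = path_weight q V u * q (V u)"
  by (simp add: path_weight_def lessThan_Suc mult.commute)

lemma position_Nil [simp]: "position X \<omega> [] = 0"
  by (simp add: position_def)

lemma position_snoc [simp]: "position X \<omega> (u @ [i]) = position X \<omega> u + X u i \<omega>"
  by (simp add: position_def lessThan_Suc nth_append)

lemma Nil_in_tree [simp]: "[] \<in> tree N \<omega>"
  by (simp add: tree_def)

lemma snoc_in_tree [simp]: "u @ [i] \<in> tree N \<omega> \<longleftrightarrow> u \<in> tree N \<omega> \<and> enat i < N u \<omega>"
  by (auto simp: tree_def nth_append less_Suc_eq)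

abbreviation offspring_space :: "(enat \<times> (nat \<Rightarrow> real)) measure"
  where "offspring_space \<equiv> count_space UNIV \<Otimes>\<^sub>M (\<Pi>\<^sub>M i\<in>UNIV. borel)"

text \<open>
  The contribution of the label \<open>u\<close> to an additive functional of the tree; it vanishes if \<open>u\<close> is not
  born.
\<close>

definition particle_term ::
  "(real \<Rightarrow> ennreal) \<Rightarrow> (real \<Rightarrow> ennreal) \<Rightarrow> (label \<Rightarrow> 'w \<Rightarrow> enat) \<Rightarrow> (label \<Rightarrow> nat \<Rightarrow> 'w \<Rightarrow> real)
    \<Rightarrow> label \<Rightarrow> 'w \<Rightarrow> ennreal"
  where "particle_term q h N X u \<omega> =
    indicator (tree N \<omega>) u * path_weight q (position X \<omega>) u * h (position X \<omega> u)"

lemma measurable_position: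
  assumes "\<And>j. j < length u \<Longrightarrow> X (take j u) (u ! j) \<in> borel_measurable S"
  shows "(\<lambda>\<omega>. position X \<omega> u) \<in> borel_measurable S"
  unfolding position_def using assms by (intro borel_measurable_sum) auto

lemma measurable_particle_term:
  assumes X: "\<And>j i. j < length u \<Longrightarrow> X (take j u) i \<in> borel_measurable S"
    and N: "\<And>j. j < length u \<Longrightarrow> N (take j u) \<in> S \<rightarrow>\<^sub>M count_space UNIV"
    and [measurable]: "q \<in> borel_measurable borel" "h \<in> borel_measurable borel"
  shows "particle_term q h N X u \<in> borel_measurable S"
proof -
  have V: "(\<lambda>\<omega>. position X \<omega> (take k u)) \<in> borel_measurable S" if "k \<le> length u" for k
    using that by (intro measurable_position) (auto simp: min_def intro!: X split: if_splits)
  have "(\<lambda>\<omega>. path_weight q (position X \<omega>) u) \<in> borel_measurable S"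
    unfolding path_weight_def
    by (intro borel_measurable_prod_ennreal measurable_compose[OF V assms(3)]) auto
  moreover have "(\<lambda>\<omega>. h (position X \<omega> u)) \<in> borel_measurable S"
    using measurable_compose[OF V[of "length u"] assms(4)] by simp
  moreover have "Measurable.pred S (\<lambda>\<omega>. u \<in> tree N \<omega>)"
  proof -
    have "Measurable.pred S (\<lambda>\<omega>. \<forall>j\<in>{..<length u}. enat (u ! j) < N (take j u) \<omega>)"
    proof (rule pred_intros_finite)
      fix j assume "j \<in> {..<length u}"
      then have "N (take j u) \<in> S \<rightarrow>\<^sub>M count_space UNIV" by (intro N) simp
      then show "Measurable.pred S (\<lambda>\<omega>. enat (u ! j) < N (take j u) \<omega>)"
        by (rule measurable_compose) simp
    qed simp
    moreover have "(\<lambda>\<omega>. u \<in> tree N \<omega>) = (\<lambda>\<omega>. \<forall>j\<in>{..<length u}. enat (u ! j) < N (take j u) \<omega>)"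
      by (auto simp: tree_def fun_eq_iff)
    ultimately show ?thesis by (simp only:)
  qed
  then have "(\<lambda>\<omega>. if u \<in> tree N \<omega> then 1 else 0 :: ennreal) \<in> borel_measurable S"
    by (intro measurable_If) auto
  then have "(\<lambda>\<omega>. indicator (tree N \<omega>) u :: ennreal) \<in> borel_measurable S"
    unfolding indicator_def of_bool_def .
  ultimately show ?thesis
    unfolding particle_term_def by (intro borel_measurable_times_ennreal)
qed

context branching_random_walk
begin

lemma measurable_particle_term' [measurable]:
  assumes "q \<in> borel_measurable borel" "h \<in> borel_measurable borel"
  shows "particle_term q h N X u \<in> borel_measurable M"
  using assms by (intro measurable_particle_term) auto

lemma particle_term_children:
  "(\<Sum>i. particle_term q h N X (u @ [i]) \<omega>) =
    indicator (tree N \<omega>) u * path_weight q (position X \<omega>) u * q (position X \<omega> u)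
      * (\<Sum>i. indicator {i. enat i < N u \<omega>} i * h (position X \<omega> u + X u i \<omega>))"
  by (subst ennreal_suminf_cmult[symmetric])
     (auto intro!: suminf_cong simp: particle_term_def indicator_def mult_ac)

text \<open>
  The first moment of the children of \<open>u\<close>. The birth, the position and the weight of \<open>u\<close>
  involve only the offspring of proper prefixes of \<open>u\<close>, which are independent of the offspring of
  \<open>u\<close> itself; so the latter may be integrated out first, with the position of \<open>u\<close> held fixed.
\<close>

lemma nn_integral_children:
  assumes [measurable]: "q \<in> borel_measurable borel" "h \<in> borel_measurable borel"
  shows "(\<Sum>i. \<integral>\<^sup>+\<omega>. particle_term q h N X (u @ [i]) \<omega> \<partial>M)
    = (\<integral>\<^sup>+\<omega>. particle_term q (\<lambda>x. q x * (\<integral>\<^sup>+y. h (x + y) \<partial>intensity M (offspring N X []))) N X u \<omega> \<partial>M)"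
proof -
  define P where "P = (\<lambda>j. take j u) ` {..<length u}"
  define A where "A = (\<Pi>\<^sub>M v\<in>P. offspring_space)"
  define Y where "Y = (\<lambda>\<omega>. restrict (\<lambda>v. (N v \<omega>, \<lambda>i. X v i \<omega>)) P)"
  \<comment> \<open>The offspring of \<open>u\<close> is kept as a family indexed by \<open>{u}\<close>: the two sides of \<open>indep_var\<close> must have the same type.\<close>
  define C where "C = (\<Pi>\<^sub>M v\<in>{u}. offspring_space)"
  define Z where "Z = (\<lambda>\<omega>. restrict (\<lambda>v. (N v \<omega>, \<lambda>i. X v i \<omega>)) {u})"
  define N' where "N' = (\<lambda>v (y :: label \<Rightarrow> enat \<times> (nat \<Rightarrow> real)). fst (y v))"
  define X' where "X' = (\<lambda>v i (y :: label \<Rightarrow> enat \<times> (nat \<Rightarrow> real)). snd (y v) i)"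
  have inP: "take j u \<in> P" if "j < length u" for j
    using that by (auto simp: P_def)
  have "u \<notin> P"
    by (auto simp: P_def) (metis length_take less_irrefl min.absorb4)
  have YA [measurable]: "Y \<in> M \<rightarrow>\<^sub>M A"
    unfolding Y_def A_def by (rule measurable_restrict) simp
  have ZS [measurable]: "Z \<in> M \<rightarrow>\<^sub>M C"
    unfolding Z_def C_def by (rule measurable_restrict) simp
  have ind: "indep_var A Y C Z"
    unfolding A_def Y_def C_def Z_def using \<open>u \<notin> P\<close> by (intro indep_var_restrict[OF indep_offspring]) auto
  have "prob_space (distr M A Y)" "prob_space (distr M C Z)"
    by (auto intro: prob_space_distr)
  then interpret Y: prob_space "distr M A Y" + Z: prob_space "distr M C Z"
    by auto
  interpret YZ: pair_sigma_finite "distr M A Y" "distr M C Z" ..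

  have mX': "X' v i \<in> borel_measurable A" if "v \<in> P" for v i
  proof -
    have "(\<lambda>y. snd (y v)) \<in> A \<rightarrow>\<^sub>M (\<Pi>\<^sub>M i\<in>UNIV. borel)"
      unfolding A_def using that by measurable
    from measurable_compose[OF this measurable_component_singleton[of i]] show ?thesis
      by (simp add: X'_def)
  qed
  have mN': "N' v \<in> A \<rightarrow>\<^sub>M count_space UNIV" if "v \<in> P" for v
    unfolding A_def N'_def using that by measurable
  have [measurable]: "(\<lambda>y. position X' y u) \<in> borel_measurable A"
    by (intro measurable_position mX' inP)
  have term_eq: "particle_term q f N' X' u (Y \<omega>) = particle_term q f N X u \<omega>" for f \<omega>
  proof -
    have 1: "position X' (Y \<omega>) (take k u) = position X \<omega> (take k u)" if "k \<le> length u" for k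
      unfolding position_def X'_def Y_def using that inP
      by (intro sum.cong) (auto simp: min_def split: if_splits)
    have 2: "u \<in> tree N' (Y \<omega>) \<longleftrightarrow> u \<in> tree N \<omega>"
      unfolding tree_def N'_def Y_def using inP by auto
    show ?thesis
      unfolding particle_term_def path_weight_def using 1 1[of "length u"] 2
      by (auto simp: indicator_def)
  qed
  have pos_eq: "position X' (Y \<omega>) u = position X \<omega> u" for \<omega>
    unfolding position_def X'_def Y_def using inP by (intro sum.cong) auto

  define F where "F = (\<lambda>(y, z). particle_term q q N' X' u y
      * (\<Sum>i. indicator {i. enat i < fst (z u)} i * h (position X' y u + snd (z u) i)))"
  have [measurable]: "particle_term q f N' X' u \<in> borel_measurable A" if "f \<in> borel_measurable borel" for f
    using that by (intro measurable_particle_term mX' mN' inP) auto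
  have zu: "(\<lambda>z. z u) \<in> C \<rightarrow>\<^sub>M offspring_space"
    unfolding C_def by (rule measurable_component_singleton) simp
  have [measurable]: "(\<lambda>z. fst (z u)) \<in> C \<rightarrow>\<^sub>M count_space UNIV"
    using measurable_compose[OF zu measurable_fst] by simp
  have [measurable]: "(\<lambda>z. snd (z u) i) \<in> borel_measurable C" for i
    using measurable_compose[OF measurable_compose[OF zu measurable_snd] measurable_component_singleton[of i]] by simp
  have [measurable]: "F \<in> borel_measurable (A \<Otimes>\<^sub>M C)"
    unfolding F_def indicator_def by measurable

  have inner: "(\<integral>\<^sup>+z. F (y, z) \<partial>distr M C Z)
      = particle_term q (\<lambda>x. q x * (\<integral>\<^sup>+y. h (x + y) \<partial>intensity M (offspring N X []))) N' X' u y" for y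
  proof -
    have "(\<integral>\<^sup>+z. F (y, z) \<partial>distr M C Z)
      = particle_term q q N' X' u y * (\<integral>\<^sup>+z. (\<Sum>i. indicator {i. enat i < fst (z u)} i * h (position X' y u + snd (z u) i)) \<partial>distr M C Z)"
      unfolding F_def by (simp add: nn_integral_cmult indicator_def)
    also have "(\<integral>\<^sup>+z. (\<Sum>i. indicator {i. enat i < fst (z u)} i * h (position X' y u + snd (z u) i)) \<partial>distr M C Z)
       = (\<integral>\<^sup>+\<omega>. (\<Sum>i. indicator {i. enat i < N u \<omega>} i * h (position X' y u + X u i \<omega>)) \<partial>M)"
      unfolding indicator_def by (subst nn_integral_distr[OF ZS], measurable) (simp add: Z_def)
    also have "\<dots> = (\<integral>\<^sup>+\<omega>. \<integral>\<^sup>+x. h (position X' y u + x) \<partial>offspring N X u \<omega> \<partial>M)"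
      by (subst nn_integral_offspring) auto
    also have "\<dots> = (\<integral>\<^sup>+x. h (position X' y u + x) \<partial>intensity M (offspring N X []))"
      by (rule nn_integral_intensity) measurable
    finally show ?thesis
      by (simp add: particle_term_def mult_ac)
  qed
  have "(\<Sum>i. \<integral>\<^sup>+\<omega>. particle_term q h N X (u @ [i]) \<omega> \<partial>M)
      = (\<integral>\<^sup>+\<omega>. (\<Sum>i. particle_term q h N X (u @ [i]) \<omega>) \<partial>M)"
    by (rule nn_integral_suminf[symmetric]) measurable
  also have "\<dots> = (\<integral>\<^sup>+\<omega>. F (Y \<omega>, Z \<omega>) \<partial>M)"
    unfolding particle_term_children
    by (intro nn_integral_cong) (unfold F_def split term_eq pos_eq, simp add: Z_def particle_term_def)
  also have "\<dots> = (\<integral>\<^sup>+p. F p \<partial>distr M (A \<Otimes>\<^sub>M C) (\<lambda>\<omega>. (Y \<omega>, Z \<omega>)))"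
    by (subst nn_integral_distr) auto
  also have "\<dots> = (\<integral>\<^sup>+p. F p \<partial>(distr M A Y \<Otimes>\<^sub>M distr M C Z))"
    using ind by (simp add: indep_var_distribution_eq)
  also have "\<dots> = (\<integral>\<^sup>+y. \<integral>\<^sup>+z. F (y, z) \<partial>distr M C Z \<partial>distr M A Y)"
    by (rule Z.nn_integral_fst[symmetric]) simp
  also have "\<dots> = (\<integral>\<^sup>+\<omega>. (\<integral>\<^sup>+z. F (Y \<omega>, z) \<partial>distr M C Z) \<partial>M)"
    by (rule nn_integral_distr) (auto intro!: Z.borel_measurable_nn_integral)
  finally show ?thesis
    unfolding inner term_eq .
qed

end

lemma nn_integral_count_space_list:
  fixes f :: "nat list \<Rightarrow> ennreal"
  shows "(\<integral>\<^sup>+w. f w \<partial>count_space UNIV) = f [] + (\<Sum>i. \<integral>\<^sup>+w. f (i # w) \<partial>count_space UNIV)"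
proof -
  have bij: "bij_betw (\<lambda>(i, w). i # w) UNIV (- {[]} :: nat list set)"
    by (rule bij_betw_byWitness[where f' = "\<lambda>w. (hd w, tl w)"]) auto
  have "(\<integral>\<^sup>+w. f w \<partial>count_space UNIV)
      = (\<integral>\<^sup>+w. f w * indicator {[]} w + f w * indicator (- {[]}) w \<partial>count_space UNIV)"
    by (intro nn_integral_cong) (auto simp: indicator_def)
  also have "\<dots> = (\<integral>\<^sup>+w. f w * indicator {[]} w \<partial>count_space UNIV) + (\<integral>\<^sup>+w. f w * indicator (- {[]}) w \<partial>count_space UNIV)"
    by (rule nn_integral_add) auto
  also have "(\<integral>\<^sup>+w. f w * indicator {[]} w \<partial>count_space UNIV) = f []"
    by (subst nn_integral_indicator_finite) auto
  also have "(\<integral>\<^sup>+w. f w * indicator (- {[]}) w \<partial>count_space UNIV) = (\<integral>\<^sup>+w. f w \<partial>count_space (- {[]}))"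
    by (simp add: nn_integral_count_space_indicator)
  also have "\<dots> = (\<integral>\<^sup>+p. f (fst p # snd p) \<partial>count_space UNIV)"
    using nn_integral_bij_count_space[OF bij, of f] by (simp add: case_prod_beta)
  also have "\<dots> = (\<integral>\<^sup>+i. \<integral>\<^sup>+w. f (i # w) \<partial>count_space UNIV \<partial>count_space UNIV)"
    by (subst nn_integral_fst_count_space[symmetric]) simp
  also have "\<dots> = (\<Sum>i. \<integral>\<^sup>+w. f (i # w) \<partial>count_space UNIV)"
    by (rule nn_integral_count_space_nat)
  finally show ?thesis .
qed

text \<open>
  Iterating the drop condition over \<open>n\<close> generations below \<open>u\<close> bounds the sum of \<open>r\<close> over these
  generations by \<open>a u\<close>; the part of \<open>a\<close> left over at the last generation is discarded.
\<close>

lemma tree_potential_bound: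
  fixes a r :: "label \<Rightarrow> ennreal"
  assumes drop: "\<And>u. (\<Sum>i. a (u @ [i])) + r u \<le> a u"
  shows "(\<integral>\<^sup>+u. r u \<partial>count_space UNIV) \<le> a []"
proof -
  have fin: "(\<integral>\<^sup>+w. r (u @ w) * indicator {w. length w < n} w \<partial>count_space UNIV) \<le> a u" for n u
  proof (induction n arbitrary: u)
    case 0
    then show ?case by simp
  next
    case (Suc n)
    have "(\<integral>\<^sup>+w. r (u @ w) * indicator {w. length w < Suc n} w \<partial>count_space UNIV)
        = r u + (\<Sum>i. \<integral>\<^sup>+w. r ((u @ [i]) @ w) * indicator {w. length w < n} w \<partial>count_space UNIV)"
      by (subst nn_integral_count_space_list) (simp add: indicator_def)
    also have "\<dots> \<le> r u + (\<Sum>i. a (u @ [i]))"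
      by (intro add_left_mono suminf_le Suc.IH) auto
    also have "\<dots> \<le> a u" using drop[of u] by (simp add: add.commute)
    finally show ?case .
  qed
  have "(\<integral>\<^sup>+u. r u \<partial>count_space UNIV) = (\<integral>\<^sup>+w. (SUP n. r w * indicator {w. length w < n} w) \<partial>count_space UNIV)"
  proof (intro nn_integral_cong antisym)
    fix w :: label
    show "r w \<le> (SUP n. r w * indicator {w. length w < n} w)"
      by (rule SUP_upper2[of "Suc (length w)"]) auto
    show "(SUP n. r w * indicator {w. length w < n} w) \<le> r w"
      by (rule SUP_least) (simp add: indicator_def)
  qed
  also have "\<dots> = (SUP n. \<integral>\<^sup>+w. r w * indicator {w. length w < n} w \<partial>count_space UNIV)"
    by (rule nn_integral_monotone_convergence_SUP) (auto simp: incseq_def le_fun_def indicator_def)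
  also have "\<dots> \<le> a []"
    using fin[of "[]"] by (intro SUP_least) simp
  finally show ?thesis .
qed

context branching_random_walk
begin

text \<open>
  The supermartingale argument. The sums over a generation of the path weight times \<open>h\<close> have decreasing
  expectations, and in passing from one generation to the next the decrease is at least the
  expected sum of the path weight times \<open>r\<close>. Adding up the decreases bounds the
  sum over the whole tree by the initial value \<open>h 0\<close>. Stopping lines are covered as well: a factor
  \<open>q = 0\<close> removes the descendants of a particle.
\<close>

lemma expected_additive_functional:
  assumes [measurable]: "q \<in> borel_measurable borel" "h \<in> borel_measurable borel" "r \<in> borel_measurable borel"
    and drop: "\<And>x. q x * (\<integral>\<^sup>+y. h (x + y) \<partial>intensity M (offspring N X [])) + r x \<le> h x"
  shows "(\<integral>\<^sup>+\<omega>. \<integral>\<^sup>+u. particle_term q r N X u \<omega> \<partial>count_space UNIV \<partial>M) \<le> h 0"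
proof -
  let ?Ph = "\<lambda>x. q x * (\<integral>\<^sup>+y. h (x + y) \<partial>intensity M (offspring N X []))"
  have "(\<integral>\<^sup>+\<omega>. \<integral>\<^sup>+u. particle_term q r N X u \<omega> \<partial>count_space UNIV \<partial>M)
      = (\<integral>\<^sup>+u. \<integral>\<^sup>+\<omega>. particle_term q r N X u \<omega> \<partial>M \<partial>count_space UNIV)"
    by (rule nn_integral_count_space_nn_integral) auto
  also have "\<dots> \<le> (\<integral>\<^sup>+\<omega>. particle_term q h N X [] \<omega> \<partial>M)"
  proof (rule tree_potential_bound)
    fix u
    have "(\<Sum>i. \<integral>\<^sup>+\<omega>. particle_term q h N X (u @ [i]) \<omega> \<partial>M) + (\<integral>\<^sup>+\<omega>. particle_term q r N X u \<omega> \<partial>M)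
        = (\<integral>\<^sup>+\<omega>. particle_term q ?Ph N X u \<omega> \<partial>M) + (\<integral>\<^sup>+\<omega>. particle_term q r N X u \<omega> \<partial>M)"
      by (subst nn_integral_children) auto
    also have "\<dots> = (\<integral>\<^sup>+\<omega>. particle_term q ?Ph N X u \<omega> + particle_term q r N X u \<omega> \<partial>M)"
      by (intro nn_integral_add[symmetric] measurable_particle_term' borel_measurable_times_ennreal
            measurable_nn_integral_intensity assms)
    also have "\<dots> \<le> (\<integral>\<^sup>+\<omega>. particle_term q h N X u \<omega> \<partial>M)"
    proof (rule nn_integral_mono)
      fix \<omega>
      have "particle_term q ?Ph N X u \<omega> + particle_term q r N X u \<omega>
          = indicator (tree N \<omega>) u * path_weight q (position X \<omega>) u
            * (?Ph (position X \<omega> u) + r (position X \<omega> u))"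
        by (simp add: particle_term_def distrib_left)
      also have "\<dots> \<le> particle_term q h N X u \<omega>"
        unfolding particle_term_def by (intro mult_left_mono drop) simp
      finally show "particle_term q ?Ph N X u \<omega> + particle_term q r N X u \<omega> \<le> particle_term q h N X u \<omega>" .
    qed
    finally show "(\<Sum>i. \<integral>\<^sup>+\<omega>. particle_term q h N X (u @ [i]) \<omega> \<partial>M) + (\<integral>\<^sup>+\<omega>. particle_term q r N X u \<omega> \<partial>M)
        \<le> (\<integral>\<^sup>+\<omega>. particle_term q h N X u \<omega> \<partial>M)" .
  qed
  also have "\<dots> = h 0"
    by (simp add: particle_term_def emeasure_space_1)
  finally show ?thesis .
qed

end

section \<open>The lowest particle and discounted visits\<close>

lemma ex_first_prefix:
  assumes "P u"
  obtains j where "j \<le> length u" "P (take j u)" "\<And>i. i < j \<Longrightarrow> \<not> P (take i u)"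
proof -
  define j where "j = (LEAST j. P (take j u))"
  have "P (take (length u) u)" using assms by simp
  then have "P (take j u)" "j \<le> length u"
    unfolding j_def by (rule LeastI, intro Least_le) 
  moreover have "\<not> P (take i u)" if "i < j" for i
    using that unfolding j_def by (rule not_less_Least)
  ultimately show ?thesis using that by blast
qed

lemma take_in_tree: "u \<in> tree N \<omega> \<Longrightarrow> take j u \<in> tree N \<omega>"
  by (auto simp: tree_def min_def split: if_splits)

context branching_random_walk
begin

abbreviation \<mu> :: "real measure"
  where "\<mu> \<equiv> intensity M (offspring N X [])"

lemma measurable_in_tree [measurable]: "Measurable.pred M (\<lambda>\<omega>. u \<in> tree N \<omega>)"
proof -
  have "particle_term (\<lambda>_. 1) (\<lambda>_. 1) N X u \<in> borel_measurable M" by simp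
  then have "Measurable.pred M (\<lambda>\<omega>. particle_term (\<lambda>_. 1) (\<lambda>_. 1) N X u \<omega> = 1)"
    by measurable
  moreover have "particle_term (\<lambda>_. 1) (\<lambda>_. 1) N X u \<omega> = 1 \<longleftrightarrow> u \<in> tree N \<omega>" for \<omega>
    by (simp add: particle_term_def path_weight_def indicator_def)
  ultimately show ?thesis by simp
qed

lemma measurable_position' [measurable]: "(\<lambda>\<omega>. position X \<omega> u) \<in> borel_measurable M"
  by (intro measurable_position) simp

lemma survival_in_sets: "survival M N \<in> sets M"
proof -
  have "infinite T \<longleftrightarrow> (\<forall>F\<in>Collect finite. \<exists>u. \<not> (u \<in> T \<longleftrightarrow> u \<in> F))" for T :: "label set"
    by (metis mem_Collect_eq set_eqI)
  then have "survival M N = {\<omega> \<in> space M. \<forall>F\<in>Collect finite. \<exists>u. \<not> (u \<in> tree N \<omega> \<longleftrightarrow> u \<in> F)}"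
    unfolding survival_def by simp
  also have "\<dots> \<in> sets M"
    by (intro sets.sets_Collect_countable_All' countable_Collect_finite) measurable
  finally show ?thesis .
qed

lemma below_barrier_in_sets [measurable]:
  "{\<omega> \<in> space M. \<exists>u\<in>tree N \<omega>. position X \<omega> u < c} \<in> sets M"
  unfolding Bex_def by measurable

text \<open>
  Stop every line when it first falls below \<open>- K\<close>. By \<open>expected_additive_functional\<close>, with \<open>h x = e\<^sup>-\<^sup>t\<^sup>x\<close>,
  the expected sum of \<open>e\<^sup>-\<^sup>t\<^sup>V\<close> over the stopped particles is at most 1, while each of them
  contributes at least \<open>e\<^sup>t\<^sup>K\<close>.
\<close>

lemma prob_below_barrier_le:
  fixes t K :: real
  assumes t: "t > 0" and tilt: "(\<integral>\<^sup>+y. ennreal (exp (- t * y)) \<partial>\<mu>) = 1"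
  shows "emeasure M {\<omega> \<in> space M. \<exists>u\<in>tree N \<omega>. position X \<omega> u < - K} \<le> ennreal (exp (- t * K))"
proof -
  define q :: "real \<Rightarrow> ennreal" where "q = indicator {- K..}"
  define h :: "real \<Rightarrow> ennreal" where "h = (\<lambda>x. ennreal (exp (- t * x)))"
  define r :: "real \<Rightarrow> ennreal" where "r = (\<lambda>x. h x * indicator {..<- K} x)"
  have [measurable]: "q \<in> borel_measurable borel" "h \<in> borel_measurable borel" "r \<in> borel_measurable borel"
    unfolding q_def h_def r_def by measurable
  have tilt_add: "exp (- t * (x + y)) = exp (- t * x) * exp (- t * y)" for x y
    by (simp add: algebra_simps flip: exp_add)
  have Ph: "(\<integral>\<^sup>+y. h (x + y) \<partial>\<mu>) = h x" for x
  proof -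
    have "(\<integral>\<^sup>+y. h (x + y) \<partial>\<mu>) = (\<integral>\<^sup>+y. h x * ennreal (exp (- t * y)) \<partial>\<mu>)"
      unfolding h_def tilt_add by (simp add: ennreal_mult')
    also have "\<dots> = h x"
      using tilt by (subst nn_integral_cmult) simp_all
    finally show ?thesis .
  qed
  have "(\<integral>\<^sup>+\<omega>. \<integral>\<^sup>+u. particle_term q r N X u \<omega> \<partial>count_space UNIV \<partial>M) \<le> h 0"
    by (rule expected_additive_functional) (auto simp: Ph q_def r_def indicator_def)
  also have "h 0 = 1" by (simp add: h_def)
  finally have total: "(\<integral>\<^sup>+\<omega>. \<integral>\<^sup>+u. particle_term q r N X u \<omega> \<partial>count_space UNIV \<partial>M) \<le> 1" .
  let ?B = "{\<omega> \<in> space M. \<exists>u\<in>tree N \<omega>. position X \<omega> u < - K}"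
  have [measurable]: "?B \<in> sets M" by measurable
  have "ennreal (exp (t * K)) * indicator ?B \<omega> \<le> (\<integral>\<^sup>+u. particle_term q r N X u \<omega> \<partial>count_space UNIV)" for \<omega>
  proof (cases "\<omega> \<in> ?B")
    case True
    then obtain u where "u \<in> tree N \<omega>" "position X \<omega> u < - K" by auto
    then obtain v where v: "v \<in> tree N \<omega>" "position X \<omega> v < - K"
      and anc: "\<And>i. i < length v \<Longrightarrow> \<not> position X \<omega> (take i v) < - K"
    proof -
      obtain j where j: "j \<le> length u" "position X \<omega> (take j u) < - K" "\<And>i. i < j \<Longrightarrow> \<not> position X \<omega> (take i u) < - K"
        using ex_first_prefix[of "\<lambda>v. position X \<omega> v < - K" u] \<open>position X \<omega> u < - K\<close> by blast
      show ?thesis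
        by (rule that[of "take j u"]) (use j take_in_tree[OF \<open>u \<in> tree N \<omega>\<close>] in \<open>auto simp: min_def split: if_splits\<close>)
    qed
    have "path_weight q (position X \<omega>) v = 1"
      unfolding path_weight_def using anc by (intro prod.neutral) (auto simp: q_def indicator_def not_less)
    then have "particle_term q r N X v \<omega> = h (position X \<omega> v)"
      using v by (simp add: particle_term_def r_def)
    moreover have "ennreal (exp (t * K)) \<le> h (position X \<omega> v)"
      unfolding h_def using mult_strict_left_mono[OF v(2) t] by (intro ennreal_leI) simp
    moreover have "particle_term q r N X v \<omega> \<le> (\<integral>\<^sup>+u. particle_term q r N X u \<omega> \<partial>count_space UNIV)"
      by (rule nn_integral_ge_point) simp
    ultimately show ?thesis using True by (simp add: indicator_def)
  qed simp
  then have "(\<integral>\<^sup>+\<omega>. ennreal (exp (t * K)) * indicator ?B \<omega> \<partial>M) \<le> 1"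
    using total by (meson nn_integral_mono order_trans)
  then have le: "ennreal (exp (t * K)) * emeasure M ?B \<le> 1"
    by (simp add: nn_integral_cmult_indicator)
  have "emeasure M ?B = ennreal (exp (- t * K)) * (ennreal (exp (t * K)) * emeasure M ?B)"
    by (simp add: mult.assoc[symmetric] flip: ennreal_mult' exp_add)
  also have "\<dots> \<le> ennreal (exp (- t * K)) * 1"
    using le by (intro mult_left_mono) auto
  finally show ?thesis by simp
qed

lemma AE_bounded_below:
  fixes t :: real
  assumes t: "t > 0" and tilt: "(\<integral>\<^sup>+y. ennreal (exp (- t * y)) \<partial>\<mu>) = 1"
  shows "AE \<omega> in M. \<exists>K::nat. \<forall>u\<in>tree N \<omega>. - real K \<le> position X \<omega> u"
proof -
  let ?B = "\<lambda>K::nat. {\<omega> \<in> space M. \<exists>u\<in>tree N \<omega>. position X \<omega> u < - real K}"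
  let ?S = "{\<omega> \<in> space M. \<forall>K::nat. \<exists>u\<in>tree N \<omega>. position X \<omega> u < - real K}"
  have [measurable]: "?S \<in> sets M" unfolding Bex_def by measurable
  have "emeasure M ?S \<le> ennreal (exp (- t * real K))" for K :: nat
    by (rule order_trans[OF emeasure_mono prob_below_barrier_le[OF assms, of "real K"]])
      (auto simp: below_barrier_in_sets)
  moreover have "(\<lambda>K. ennreal (exp (- t * real K))) \<longlonglongrightarrow> ennreal 0"
    using t by (intro tendsto_ennrealI) real_asymp
  ultimately have "emeasure M ?S \<le> ennreal 0"
    by (intro LIMSEQ_le_const) blast+
  then have "?S \<in> null_sets M" by (simp add: null_sets_def)
  then have "AE \<omega> in M. \<omega> \<notin> ?S" by (rule AE_not_in)
  then show ?thesis
    using AE_space by eventually_elim (auto simp: not_less)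
qed

text \<open>
  Apply \<open>expected_additive_functional\<close> to \<open>h x = e\<^sup>-\<^sup>t\<^sup>x H x\<close>. At a visit to \<open>J\<close> the mean of \<open>H\<close> drops to at
  most \<open>1 - d\<close>. This pays for a factor \<open>1 + d / 2\<close> on all the descendants and for a
  contribution \<open>d / 2\<close> of the visitor itself, because \<open>(1 + d / 2) (1 - d) + d / 2 \<le> 1\<close>. So
  particles in \<open>J\<close> are counted with a weight exponential in the number of ancestors in \<open>J\<close>.
  Lines are killed when they leave \<open>D\<close>.
\<close>

lemma expected_discounted_visits:
  fixes t d :: real and H :: "real \<Rightarrow> ennreal"
  assumes d: "0 < d" "d \<le> 1"
    and [measurable]: "D \<in> sets borel" "J \<in> sets borel"
    and escape: "escape_function (density \<mu> (\<lambda>x. ennreal (exp (- t * x)))) D J d H"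
  shows "(\<integral>\<^sup>+\<omega>. \<integral>\<^sup>+u. particle_term (\<lambda>x. indicator D x * ennreal (if x \<in> J then 1 + d / 2 else 1))
      (\<lambda>x. indicator J x * ennreal (d / 2 * exp (- t * x))) N X u \<omega> \<partial>count_space UNIV \<partial>M) \<le> 1"
proof -
  have [measurable]: "H \<in> borel_measurable borel"
    and H_le: "\<And>x. H x \<le> 1" and H_J: "\<And>x. x \<in> J \<Longrightarrow> H x = 1"
    using escape by (auto simp: escape_function_def)
  have tilted: "(\<integral>\<^sup>+y. H (x + y) \<partial>density \<mu> (\<lambda>x. ennreal (exp (- t * x))))
      = (\<integral>\<^sup>+y. ennreal (exp (- t * y)) * H (x + y) \<partial>\<mu>)" for x
    by (rule nn_integral_density) simp_all
  have super: "\<And>x. x \<in> D \<Longrightarrow> (\<integral>\<^sup>+y. ennreal (exp (- t * y)) * H (x + y) \<partial>\<mu>) \<le> H x"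
    and drop: "\<And>x. x \<in> J \<Longrightarrow> (\<integral>\<^sup>+y. ennreal (exp (- t * y)) * H (x + y) \<partial>\<mu>) \<le> ennreal (1 - d)"
    using escape unfolding escape_function_def tilted by blast+
  define q :: "real \<Rightarrow> ennreal" where "q = (\<lambda>x. indicator D x * ennreal (if x \<in> J then 1 + d / 2 else 1))"
  define r :: "real \<Rightarrow> ennreal" where "r = (\<lambda>x. indicator J x * ennreal (d / 2 * exp (- t * x)))"
  define h :: "real \<Rightarrow> ennreal" where "h = (\<lambda>x. ennreal (exp (- t * x)) * H x)"
  define PH where "PH = (\<lambda>x. \<integral>\<^sup>+y. ennreal (exp (- t * y)) * H (x + y) \<partial>\<mu>)"
  have [measurable]: "q \<in> borel_measurable borel" "h \<in> borel_measurable borel" "r \<in> borel_measurable borel"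
    unfolding q_def h_def r_def by measurable
  have tilt_add: "exp (- t * (x + y)) = exp (- t * x) * exp (- t * y)" for x y
    by (simp add: algebra_simps flip: exp_add)
  have Ph: "(\<integral>\<^sup>+y. h (x + y) \<partial>\<mu>) = ennreal (exp (- t * x)) * PH x" for x
  proof -
    have "(\<integral>\<^sup>+y. h (x + y) \<partial>\<mu>) = (\<integral>\<^sup>+y. ennreal (exp (- t * x)) * (ennreal (exp (- t * y)) * H (x + y)) \<partial>\<mu>)"
      unfolding h_def tilt_add by (simp add: ennreal_mult' mult.assoc)
    also have "\<dots> = ennreal (exp (- t * x)) * PH x"
      unfolding PH_def by (rule nn_integral_cmult) simp
    finally show ?thesis .
  qed
  have key: "q x * (\<integral>\<^sup>+y. h (x + y) \<partial>\<mu>) + r x \<le> h x" for x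
  proof -
    have "indicator D x * ennreal (if x \<in> J then 1 + d / 2 else 1) * PH x + indicator J x * ennreal (d / 2) \<le> H x"
    proof (cases "x \<in> J")
      case True
      have "indicator D x * ennreal (1 + d / 2) * PH x + ennreal (d / 2)
          \<le> 1 * ennreal (1 + d / 2) * ennreal (1 - d) + ennreal (d / 2)"
        using drop[OF True] by (intro add_right_mono mult_mono) (auto simp: PH_def indicator_def)
      also have "\<dots> = ennreal ((1 + d / 2) * (1 - d) + d / 2)"
        using d by (simp flip: ennreal_mult' ennreal_plus)
      also have "\<dots> \<le> ennreal 1"
        using d by (intro ennreal_leI) (simp add: algebra_simps)
      finally show ?thesis using True H_J[OF True] by simp
    next
      case False
      then show ?thesis using super[of x] by (auto simp: indicator_def PH_def)
    qed
    then have "ennreal (exp (- t * x)) * (indicator D x * ennreal (if x \<in> J then 1 + d / 2 else 1) * PH x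
        + indicator J x * ennreal (d / 2)) \<le> ennreal (exp (- t * x)) * H x"
      by (intro mult_left_mono) auto
    moreover have "r x = ennreal (exp (- t * x)) * (indicator J x * ennreal (d / 2))"
      unfolding r_def using d by (simp add: ennreal_mult mult_ac del: times_divide_eq_left)
    ultimately show ?thesis
      unfolding Ph by (simp add: q_def h_def distrib_left mult_ac)
  qed
  have "(\<integral>\<^sup>+\<omega>. \<integral>\<^sup>+u. particle_term q r N X u \<omega> \<partial>count_space UNIV \<partial>M) \<le> h 0"
    by (rule expected_additive_functional[OF _ _ _ key]) simp_all
  also have "h 0 \<le> 1" using H_le[of 0] by (simp add: h_def)
  finally show ?thesis unfolding q_def r_def .
qed

end

section \<open>Visits along a ray\<close>

lemma is_ray_step:
  assumes "\<xi> \<in> rays T"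
  shows "ray_vertex \<xi> 0 = []" "n \<in> ray_indices \<xi> \<Longrightarrow> ray_vertex \<xi> n \<in> T"
    "Suc n \<in> ray_indices \<xi> \<Longrightarrow> n \<in> ray_indices \<xi> \<and> is_parent (ray_vertex \<xi> n) (ray_vertex \<xi> (Suc n))"
proof -
  have step: "is_parent (vs ! n) (vs ! Suc n)" if "successively is_parent vs" "Suc n < length vs" for vs n
    using that
  proof (induction vs arbitrary: n)
    case (Cons v vs)
    then show ?case
      by (cases n) (auto simp: successively_Cons hd_conv_nth)
  qed simp
  show "ray_vertex \<xi> 0 = []"
    using assms by (cases \<xi>) (auto simp: rays_def hd_conv_nth)
  show "ray_vertex \<xi> n \<in> T" if "n \<in> ray_indices \<xi>"
    using assms that by (cases \<xi>) (auto simp: rays_def)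
  show "n \<in> ray_indices \<xi> \<and> is_parent (ray_vertex \<xi> n) (ray_vertex \<xi> (Suc n))" if "Suc n \<in> ray_indices \<xi>"
    using assms that step by (cases \<xi>) (auto simp: rays_def)
qed

lemma ray_vertex_prefix:
  assumes ray: "\<xi> \<in> rays T" and n: "n \<in> ray_indices \<xi>"
  shows "length (ray_vertex \<xi> n) = n"
    and "j \<le> n \<Longrightarrow> take j (ray_vertex \<xi> n) = ray_vertex \<xi> j \<and> j \<in> ray_indices \<xi>"
proof -
  have "length (ray_vertex \<xi> n) = n \<and> (\<forall>j\<le>n. take j (ray_vertex \<xi> n) = ray_vertex \<xi> j \<and> j \<in> ray_indices \<xi>)"
    using n
  proof (induction n)
    case 0
    then show ?case using is_ray_step[OF ray] by simp
  next
    case (Suc n)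
    from is_ray_step(3)[OF ray Suc.prems] obtain i
      where n: "n \<in> ray_indices \<xi>" and i: "ray_vertex \<xi> (Suc n) = ray_vertex \<xi> n @ [i]"
      by (auto simp: is_parent_def)
    have IH: "length (ray_vertex \<xi> n) = n" "\<And>j. j \<le> n \<Longrightarrow> take j (ray_vertex \<xi> n) = ray_vertex \<xi> j \<and> j \<in> ray_indices \<xi>"
      using Suc.IH[OF n] by auto
    have "take j (ray_vertex \<xi> (Suc n)) = ray_vertex \<xi> j \<and> j \<in> ray_indices \<xi>" if "j \<le> Suc n" for j
    proof (cases "j = Suc n")
      case True
      then show ?thesis using Suc.prems IH(1) i by simp
    next
      case False
      then show ?thesis using IH(1) IH(2)[of j] that i by simp
    qed
    then show ?case using IH(1) i by simp
  qed
  then show "length (ray_vertex \<xi> n) = n"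
    and "j \<le> n \<Longrightarrow> take j (ray_vertex \<xi> n) = ray_vertex \<xi> j \<and> j \<in> ray_indices \<xi>"
    by auto
qed

text \<open>
  Applied to the set of times at which a ray visits an interval: it suffices to bound, at each visit,
  the number of earlier visits, which is a property of the visiting particle alone.
\<close>

lemma card_le_if_few_predecessors:
  fixes S :: "nat set"
  assumes "\<And>n. n \<in> S \<Longrightarrow> card {j\<in>S. j < n} \<le> B"
  shows "finite S \<and> card S \<le> Suc B"
proof (rule finite_if_finite_subsets_card_bdd)
  fix F assume F: "F \<subseteq> S" "finite F"
  show "card F \<le> Suc B"
  proof (cases "F = {}")
    case False
    define n where "n = Max F"
    have n: "n \<in> F" using F False by (simp add: n_def)
    have "F \<subseteq> insert n {j\<in>S. j < n}"
      using F by (auto simp: n_def less_le)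
    then have "card F \<le> card (insert n {j\<in>S. j < n})"
      by (intro card_mono) auto
    also have "\<dots> \<le> Suc B"
      using assms[of n] n F(1) by (auto simp: card_insert_if)
    finally show ?thesis .
  qed simp
qed

text \<open>
  Only strict ancestors are counted, in accordance with \<open>path_weight\<close>.
\<close>

definition ancestor_visits :: "(label \<Rightarrow> real) \<Rightarrow> real set \<Rightarrow> label \<Rightarrow> nat"
  where "ancestor_visits V J u = card {j. j < length u \<and> V (take j u) \<in> J}"

text \<open>
  A bound on the visits of ancestors that is uniform over the tree controls all the rays at once. The unit
  interval is covered by short pieces, since escape functions exist only for short
  intervals.
\<close>

lemma visits_le:
  fixes m B :: nat
  assumes ray: "\<xi> \<in> rays T"
    and cover: "\<And>x. of_int k \<le> x \<Longrightarrow> x < of_int k + 1 \<Longrightarrow> \<exists>i<m. x \<in> J i"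
    and few: "\<And>i u. i < m \<Longrightarrow> u \<in> T \<Longrightarrow> V u \<in> J i \<Longrightarrow> ancestor_visits V (J i) u \<le> B"
  shows "visits V \<xi> k \<le> of_nat (m * Suc B)"
proof -
  define S where "S = {n \<in> ray_indices \<xi>. of_int k \<le> V (ray_vertex \<xi> n) \<and> V (ray_vertex \<xi> n) < of_int k + 1}"
  define R where "R = (\<lambda>i. {n \<in> ray_indices \<xi>. V (ray_vertex \<xi> n) \<in> J i})"
  have R: "finite (R i) \<and> card (R i) \<le> Suc B" if "i < m" for i
  proof (rule card_le_if_few_predecessors)
    fix n assume n: "n \<in> R i"
    have "{j \<in> R i. j < n} = {j. j < length (ray_vertex \<xi> n) \<and> V (take j (ray_vertex \<xi> n)) \<in> J i}"
      using n ray_vertex_prefix[OF ray, of n] by (auto simp: R_def)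
    then have "card {j \<in> R i. j < n} = ancestor_visits V (J i) (ray_vertex \<xi> n)"
      by (simp add: ancestor_visits_def)
    also have "\<dots> \<le> B"
      using n is_ray_step(2)[OF ray] by (intro few that) (auto simp: R_def)
    finally show "card {j \<in> R i. j < n} \<le> B" .
  qed
  have sub: "S \<subseteq> (\<Union>i<m. R i)"
    using cover by (force simp: S_def R_def)
  have fin: "finite (\<Union>i<m. R i)" using R by auto
  then have "finite S" using sub by (rule rev_finite_subset)
  have "card S \<le> card (\<Union>i<m. R i)" by (rule card_mono[OF fin sub])
  also have "\<dots> \<le> (\<Sum>i<m. card (R i))" by (rule card_UN_le) simp
  also have "\<dots> \<le> m * Suc B" using R sum_bounded_above[of "{..<m}" "\<lambda>i. card (R i)" "Suc B"] by simp
  finally have card: "card S \<le> m * Suc B" .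
  have "visits V \<xi> k = (\<Sum>n. indicator S n)"
    by (simp add: visits_def S_def)
  also have "\<dots> = emeasure (count_space UNIV) S"
    by (subst nn_integral_count_space_nat[symmetric]) simp
  also have "\<dots> = of_nat (card S)"
    using \<open>finite S\<close> by simp
  also have "\<dots> \<le> of_nat (m * Suc B)"
    using card by (rule of_nat_mono)
  finally show ?thesis .
qed

text \<open>
  Solve for the exponent \<open>n\<close> after taking logarithms. The factors \<open>2\<^sup>k\<close>, \<open>e\<^sup>t\<^sup>V\<close> and \<open>2 / d\<close> all
  contribute \<open>O(k)\<close>, and \<open>ln (1 + d / 2) \<ge> d / 4\<close>, so that \<open>n\<close> is \<open>O(k / d)\<close>.
\<close>

lemma exponent_bound:
  fixes C c d t V :: real and n k p :: nat
  assumes C: "1 \<le> C" and c: "0 < c" "c \<le> 1" and t: "0 < t" and d: "d = c / (real k + 1) ^ p"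
    and V: "V \<le> real k + 2"
    and le: "(1 / 2) ^ k * ((1 + d / 2) ^ n * (d / 2 * exp (- t * V))) \<le> C"
  shows "real n \<le> 4 / c * (ln C + 1 + 2 * t + ln (2 / c) + real p) * (real k + 1) ^ Suc p"
proof -
  have pow: "1 \<le> (real k + 1) ^ p" by simp
  have d01: "0 < d" "d \<le> 1"
    using c order_trans[OF c(2) pow] by (auto simp: d divide_le_eq)
  have "ln ((1 / 2) ^ k * ((1 + d / 2) ^ n * (d / 2 * exp (- t * V)))) \<le> ln C"
    using le d01 by (intro ln_mono) auto
  moreover have "ln ((1 / 2) ^ k * ((1 + d / 2) ^ n * (d / 2 * exp (- t * V))))
      = real k * ln (1 / 2) + (real n * ln (1 + d / 2) + (ln (d / 2) - t * V))"
    using d01 by (simp add: ln_mult ln_div ln_realpow)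
  ultimately have 1: "real n * ln (1 + d / 2) \<le> ln C - real k * ln (1 / 2) - ln (d / 2) + t * V"
    by simp
  have 2: "- real k * ln (1 / 2) \<le> real k"
  proof -
    have "ln (1 / 2) = - ln (2 :: real)" by (simp add: ln_div)
    moreover have "ln (2 :: real) \<le> 1" using ln_le_minus_one[of 2] by simp
    ultimately show ?thesis by (simp add: mult_left_le)
  qed
  have 3: "- ln (d / 2) \<le> ln (2 / c) + real p * real k"
  proof -
    have "- ln (d / 2) = ln (2 / c) + real p * ln (real k + 1)"
      using c by (simp add: d ln_div ln_mult ln_realpow)
    moreover have "ln (real k + 1) \<le> real k" using ln_le_minus_one[of "real k + 1"] by simp
    ultimately show ?thesis by (simp add: mult_left_mono)
  qed
  have 4: "t * V \<le> 2 * t * (real k + 1)"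
  proof -
    have "t * V \<le> t * (2 * (real k + 1))" using V t by (intro mult_left_mono) auto
    then show ?thesis by (simp add: algebra_simps)
  qed
  define A where "A = ln C + 1 + 2 * t + ln (2 / c) + real p"
  have "0 \<le> ln C" "0 \<le> ln (2 / c)" using C c by (auto intro!: ln_ge_zero simp: field_simps)
  then have "ln C + ln (2 / c) \<le> (ln C + ln (2 / c)) * (real k + 1)"
    by (simp add: mult_left_mono[of 1 "real k + 1", simplified] algebra_simps)
  then have A: "real n * ln (1 + d / 2) \<le> A * (real k + 1)"
    using 1 2 3 4 unfolding A_def by (simp add: algebra_simps)
  have "d / 4 \<le> ln (1 + d / 2)"
  proof -
    have "d / 2 - (d / 2)\<^sup>2 \<le> ln (1 + d / 2)"
      using d01 by (intro ln_one_plus_pos_lower_bound) auto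
    moreover have "d\<^sup>2 \<le> d" using d01 by (simp add: power2_eq_square mult_left_le)
    ultimately show ?thesis by (simp add: power_divide)
  qed
  then have "real n * (d / 4) \<le> A * (real k + 1)"
    using A by (meson mult_left_mono of_nat_0_le_iff order_trans)
  then have "real n \<le> 4 / d * (A * (real k + 1))"
    using d01 by (simp add: field_simps)
  also have "\<dots> = 4 / c * A * (real k + 1) ^ Suc p"
    using c pow by (simp add: d)
  finally show ?thesis unfolding A_def .
qed

lemma polynomial_bound_tendsto_0:
  fixes f :: "nat \<Rightarrow> ennreal" and q :: nat
  assumes f: "\<And>k. f k \<le> ennreal (B * (real k + 1) ^ q)" and \<kappa>: "real q < \<kappa>"
  shows "(\<lambda>n. ennreal (1 / real n powr \<kappa>) * f n) \<longlonglongrightarrow> 0"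
proof -
  define B' where "B' = max B 0"
  have upper: "eventually (\<lambda>n. ennreal (1 / real n powr \<kappa>) * f n \<le> ennreal (B' * 2 ^ q * real n powr (real q - \<kappa>))) sequentially"
    using eventually_ge_at_top[of 1]
  proof eventually_elim
    case (elim n)
    have "f n \<le> ennreal (B' * (2 * real n) ^ q)"
      using elim by (intro order_trans[OF f] ennreal_leI mult_mono power_mono) (auto simp: B'_def)
    then have "ennreal (1 / real n powr \<kappa>) * f n \<le> ennreal (1 / real n powr \<kappa>) * ennreal (B' * (2 * real n) ^ q)"
      by (rule mult_left_mono) simp
    also have "\<dots> = ennreal (B' * 2 ^ q * real n powr (real q - \<kappa>))"
      using elim by (simp add: power_mult_distrib powr_diff powr_realpow mult.assoc flip: ennreal_mult')
    finally show ?case .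
  qed
  have lim: "(\<lambda>n. ennreal (B' * 2 ^ q * real n powr (real q - \<kappa>))) \<longlonglongrightarrow> 0"
  proof -
    have "(\<lambda>n. real n powr (real q - \<kappa>)) \<longlonglongrightarrow> 0"
      using \<kappa> by (intro tendsto_neg_powr filterlim_real_sequentially) simp
    from tendsto_ennrealI[OF tendsto_mult_right_zero[OF this]] show ?thesis by simp
  qed
  show ?thesis
    by (rule tendsto_sandwich[OF always_eventually upper tendsto_const lim]) simp
qed

section \<open>Almost sure polynomial bounds\<close>

lemma path_weight_visits:
  assumes "\<And>j. j < length u \<Longrightarrow> V (take j u) \<in> D" and "0 \<le> a"
  shows "path_weight (\<lambda>x. indicator D x * ennreal (if x \<in> J then a else 1)) V u
    = ennreal (a ^ ancestor_visits V J u)"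
proof -
  have "path_weight (\<lambda>x. indicator D x * ennreal (if x \<in> J then a else 1)) V u
      = (\<Prod>j<length u. if V (take j u) \<in> J then ennreal a else 1)"
    unfolding path_weight_def using assms(1) by (intro prod.cong) auto
  also have "\<dots> = (\<Prod>j\<in>{j. j < length u \<and> V (take j u) \<in> J}. ennreal a)"
    by (simp add: prod.If_cases Int_def)
  also have "\<dots> = ennreal (a ^ ancestor_visits V J u)"
    using assms(2) by (simp add: ancestor_visits_def ennreal_power)
  finally show ?thesis .
qed

context branching_random_walk
begin

lemma measurable_sum_over_labels:
  fixes f :: "label \<Rightarrow> 'w \<Rightarrow> ennreal"
  assumes [measurable]: "\<And>u. f u \<in> borel_measurable M"
  shows "(\<lambda>\<omega>. \<integral>\<^sup>+u. f u \<omega> \<partial>count_space UNIV) \<in> borel_measurable M"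
proof -
  interpret sigma_finite_measure "count_space (UNIV :: label set)"
    by (rule sigma_finite_measure_count_space)
  have "(\<lambda>p. f (fst p) (snd p)) \<in> borel_measurable (count_space UNIV \<Otimes>\<^sub>M M)"
    by (rule measurable_pair_measure_countable1) auto
  from measurable_compose[OF measurable_pair_swap' this]
  have "(\<lambda>(\<omega>, u). f u \<omega>) \<in> borel_measurable (M \<Otimes>\<^sub>M count_space UNIV)"
    by (simp add: case_prod_beta)
  then show ?thesis by (intro borel_measurable_nn_integral)
qed

text \<open>
  Plays the part of the Borel--Cantelli lemma: the sum with weights \<open>2\<^sup>-\<^sup>k\<close> has finite expectation, so each
  term is bounded by a random constant. The resulting factor \<open>2\<^sup>k\<close> is harmless next to the
  \<open>e\<^sup>t\<^sup>k\<close> that already comes from the tilting.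
\<close>

lemma AE_finite_weighted_sum:
  fixes Z :: "nat \<Rightarrow> 'i \<Rightarrow> 'w \<Rightarrow> ennreal"
  assumes [measurable]: "\<And>k i. i \<in> I \<Longrightarrow> Z k i \<in> borel_measurable M" and "finite I"
    and Z: "\<And>k i. i \<in> I \<Longrightarrow> (\<integral>\<^sup>+\<omega>. Z k i \<omega> \<partial>M) \<le> 1"
  shows "AE \<omega> in M. \<exists>C\<ge>1. \<forall>k. \<forall>i\<in>I. ennreal ((1 / 2) ^ k) * Z k i \<omega> \<le> ennreal C"
proof -
  define S where "S = (\<lambda>\<omega>. \<Sum>k. \<Sum>i\<in>I. ennreal ((1 / 2) ^ k) * Z k i \<omega>)"
  have [measurable]: "S \<in> borel_measurable M"
    unfolding S_def by measurable
  have "(\<integral>\<^sup>+\<omega>. S \<omega> \<partial>M) = (\<Sum>k. \<integral>\<^sup>+\<omega>. (\<Sum>i\<in>I. ennreal ((1 / 2) ^ k) * Z k i \<omega>) \<partial>M)"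
    unfolding S_def by (rule nn_integral_suminf) measurable
  also have "\<dots> = (\<Sum>k. \<Sum>i\<in>I. ennreal ((1 / 2) ^ k) * (\<integral>\<^sup>+\<omega>. Z k i \<omega> \<partial>M))"
    by (simp add: nn_integral_sum nn_integral_cmult)
  also have "\<dots> \<le> (\<Sum>k. ennreal (real (card I) * (1 / 2) ^ k))"
  proof (intro suminf_le allI)
    fix k
    have "(\<Sum>i\<in>I. ennreal ((1 / 2) ^ k) * (\<integral>\<^sup>+\<omega>. Z k i \<omega> \<partial>M)) \<le> (\<Sum>i\<in>I. ennreal ((1 / 2) ^ k) * 1)"
      by (intro sum_mono mult_left_mono Z) auto
    also have "\<dots> = ennreal (real (card I) * (1 / 2) ^ k)"
      by (simp add: ennreal_mult' ennreal_of_nat_eq_real_of_nat)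
    finally show "(\<Sum>i\<in>I. ennreal ((1 / 2) ^ k) * (\<integral>\<^sup>+\<omega>. Z k i \<omega> \<partial>M)) \<le> ennreal (real (card I) * (1 / 2) ^ k)" .
  qed auto
  also have "\<dots> = ennreal (\<Sum>k. real (card I) * (1 / 2) ^ k)"
    by (intro suminf_ennreal2 summable_mult summable_geometric) auto
  also have "\<dots> < \<infinity>" by simp
  finally have "AE \<omega> in M. S \<omega> \<noteq> \<infinity>"
    by (intro nn_integral_PInf_AE) auto
  then show ?thesis
  proof eventually_elim
    case (elim \<omega>)
    then obtain C where C: "0 \<le> C" "S \<omega> = ennreal C"
      by (cases "S \<omega>" rule: ennreal_cases) auto
    have "ennreal ((1 / 2) ^ k) * Z k i \<omega> \<le> ennreal (max 1 C)" if "i \<in> I" for k i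
    proof -
      have "ennreal ((1 / 2) ^ k) * Z k i \<omega> \<le> (\<Sum>i\<in>I. ennreal ((1 / 2) ^ k) * Z k i \<omega>)"
        using that \<open>finite I\<close> by (intro member_le_sum) auto
      also have "\<dots> \<le> S \<omega>"
        unfolding S_def using sum_le_suminf[of "\<lambda>k. \<Sum>i\<in>I. ennreal ((1 / 2) ^ k) * Z k i \<omega>" "{k}"] by simp
      also have "\<dots> \<le> ennreal (max 1 C)"
        unfolding C(2) by (rule ennreal_leI) simp
      finally show ?thesis .
    qed
    then show ?case by (intro exI[of _ "max 1 C"]) auto
  qed
qed

text \<open>
  The functionals of \<open>expected_discounted_visits\<close>, for all the short intervals meeting \<open>[k, k + 1)\<close>,
  are bounded simultaneously up to the factor \<open>2\<^sup>k\<close>. A single particle contributes no more than the whole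
  sum, so \<open>exponent_bound\<close> limits the visits of its ancestors, at an escape rate of order
  \<open>k\<^sup>-\<^sup>p\<close>, to order \<open>k\<^sup>p\<^sup>+\<^sup>1\<close>.
\<close>

lemma AE_polynomial_visits:
  fixes t c \<delta> :: real and p :: nat
  defines "\<nu> \<equiv> density \<mu> (\<lambda>x. ennreal (exp (- t * x)))"
  assumes t: "0 < t" and \<delta>: "0 < \<delta>" "\<delta> \<le> 1" and c: "0 < c" "c \<le> 1"
    and D [measurable]: "D \<in> sets borel"
    and escape: "\<And>k b. real k \<le> b \<Longrightarrow> b \<le> real k + 1 \<Longrightarrow>
      \<exists>H. escape_function \<nu> D {b..b + \<delta>} (c / (real k + 1) ^ p) H"
  shows "AE \<omega> in M. (\<forall>u\<in>tree N \<omega>. position X \<omega> u \<in> D) \<longrightarrow>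
    (\<exists>B. \<forall>k. \<forall>\<xi>\<in>rays (tree N \<omega>). visits (position X \<omega>) \<xi> (int k) \<le> ennreal (B * (real k + 1) ^ Suc p))"
proof -
  define m where "m = nat \<lceil>1 / \<delta>\<rceil>"
  have m: "1 / \<delta> \<le> real m" "\<And>i. i < m \<Longrightarrow> real i * \<delta> \<le> 1"
  proof -
    show "1 / \<delta> \<le> real m" unfolding m_def by (rule real_nat_ceiling_ge)
    fix i assume "i < m"
    then have "real i < 1 / \<delta>" unfolding m_def using \<delta> by (simp add: less_ceiling_iff zless_nat_eq_int_zless)
    then show "real i * \<delta> \<le> 1" using \<delta> by (simp add: field_simps)
  qed
  define J where "J = (\<lambda>k i :: nat. {real k + real i * \<delta>..real k + real i * \<delta> + \<delta>})"
  define d where "d = (\<lambda>k :: nat. c / (real k + 1) ^ p)"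
  have d: "0 < d k" "d k \<le> 1" for k
  proof -
    have "c \<le> (real k + 1) ^ p" by (rule order_trans[OF c(2)]) simp
    then show "0 < d k" "d k \<le> 1" using c by (auto simp: d_def divide_le_eq)
  qed
  define q where "q = (\<lambda>k i x. indicator D x * ennreal (if x \<in> J k i then 1 + d k / 2 else 1))"
  define r where "r = (\<lambda>k i x. indicator (J k i) x * ennreal (d k / 2 * exp (- t * x)))"
  have [measurable]: "q k i \<in> borel_measurable borel" "r k i \<in> borel_measurable borel" for k i
    unfolding q_def r_def J_def by measurable
  define Z where "Z = (\<lambda>k i \<omega>. \<integral>\<^sup>+u. particle_term (q k i) (r k i) N X u \<omega> \<partial>count_space UNIV)"
  have [measurable]: "Z k i \<in> borel_measurable M" for k i
    unfolding Z_def by (rule measurable_sum_over_labels) simp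
  have Z: "(\<integral>\<^sup>+\<omega>. Z k i \<omega> \<partial>M) \<le> 1" if i: "i \<in> {..<m}" for k i
  proof -
    have "real k \<le> real k + real i * \<delta>" "real k + real i * \<delta> \<le> real k + 1"
      using m(2)[of i] i \<delta> by auto
    from escape[OF this] obtain H where H: "escape_function \<nu> D (J k i) (d k) H"
      by (auto simp: J_def d_def)
    then show ?thesis
      unfolding Z_def q_def r_def using d[of k] D
      by (intro expected_discounted_visits[where H = H]) (auto simp: \<nu>_def J_def)
  qed
  have "AE \<omega> in M. \<exists>C\<ge>1. \<forall>k. \<forall>i\<in>{..<m}. ennreal ((1 / 2) ^ k) * Z k i \<omega> \<le> ennreal C"
    by (rule AE_finite_weighted_sum) (use Z in auto)
  then show ?thesis
  proof eventually_elim
    case (elim \<omega>)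
    then obtain C where C: "1 \<le> C"
      and ZC: "\<And>k i. i < m \<Longrightarrow> ennreal ((1 / 2) ^ k) * Z k i \<omega> \<le> ennreal C" by auto
    define A where "A = 4 / c * (ln C + 1 + 2 * t + ln (2 / c) + real p)"
    have "0 \<le> ln C" "0 \<le> ln (2 / c)" using C c by (auto intro!: ln_ge_zero simp: field_simps)
    then have A: "0 \<le> A" unfolding A_def using c t by (intro mult_nonneg_nonneg) auto
    let ?V = "position X \<omega>"
    show ?case
    proof
      assume inD: "\<forall>u\<in>tree N \<omega>. ?V u \<in> D"
      have "visits ?V \<xi> (int k) \<le> ennreal (real m * (A + 1) * (real k + 1) ^ Suc p)"
        if ray: "\<xi> \<in> rays (tree N \<omega>)" for k \<xi>
      proof -
        define B where "B = nat \<lfloor>A * (real k + 1) ^ Suc p\<rfloor>"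
        have "visits ?V \<xi> (int k) \<le> of_nat (m * Suc B)"
        proof (rule visits_le[OF ray, where J = "J k"])
          fix x :: real assume x: "of_int (int k) \<le> x" "x < of_int (int k) + 1"
          define i where "i = nat \<lfloor>(x - real k) / \<delta>\<rfloor>"
          have i: "real i \<le> (x - real k) / \<delta>" "(x - real k) / \<delta> < real i + 1"
            unfolding i_def using x \<delta> by (auto simp: of_nat_floor)
          have "(x - real k) / \<delta> < 1 / \<delta>" using x \<delta> by (intro divide_strict_right_mono) auto
          then have "i < m" using i(1) m(1) by linarith
          moreover have "x \<in> J k i" using i \<delta> by (auto simp: J_def field_simps)
          ultimately show "\<exists>i<m. x \<in> J k i" by blast
        next
          fix i u assume i: "i < m" and u: "u \<in> tree N \<omega>" "?V u \<in> J k i"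
          have "particle_term (q k i) (r k i) N X u \<omega> \<le> Z k i \<omega>"
            unfolding Z_def by (rule nn_integral_ge_point) simp
          moreover have "path_weight (q k i) ?V u = ennreal ((1 + d k / 2) ^ ancestor_visits ?V (J k i) u)"
            unfolding q_def using inD take_in_tree[OF u(1)] d[of k] by (intro path_weight_visits) auto
          ultimately have "ennreal ((1 + d k / 2) ^ ancestor_visits ?V (J k i) u) * ennreal (d k / 2 * exp (- t * ?V u)) \<le> Z k i \<omega>"
            using u by (simp add: particle_term_def r_def)
          then have "ennreal ((1 / 2) ^ k) * (ennreal ((1 + d k / 2) ^ ancestor_visits ?V (J k i) u) * ennreal (d k / 2 * exp (- t * ?V u)))
              \<le> ennreal C"
            using ZC[OF i, of k] by (meson mult_left_mono order_trans zero_le)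
          then have "(1 / 2) ^ k * ((1 + d k / 2) ^ ancestor_visits ?V (J k i) u * (d k / 2 * exp (- t * ?V u))) \<le> C"
            using d[of k] C by (simp flip: ennreal_mult del: times_divide_eq_left)
          then have "real (ancestor_visits ?V (J k i) u) \<le> A * (real k + 1) ^ Suc p"
            unfolding A_def using u(2) m(2)[OF i] \<delta>
            by (intro exponent_bound[OF C c t d_def[THEN fun_cong]]) (auto simp: J_def)
          then show "ancestor_visits ?V (J k i) u \<le> B"
            unfolding B_def by (simp add: le_nat_floor)
        qed
        also have "\<dots> = ennreal (real (m * Suc B))"
          by (simp only: ennreal_of_nat_eq_real_of_nat)
        also have "\<dots> \<le> ennreal (real m * (A + 1) * (real k + 1) ^ Suc p)"
        proof (rule ennreal_leI)
          have "real B \<le> A * (real k + 1) ^ Suc p"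
            unfolding B_def using A by (intro of_nat_floor) simp
          moreover have "1 \<le> (real k + 1) ^ Suc p" by (rule one_le_power) simp
          ultimately have "real (Suc B) \<le> (A + 1) * (real k + 1) ^ Suc p"
            by (simp add: distrib_right)
          then show "real (m * Suc B) \<le> real m * (A + 1) * (real k + 1) ^ Suc p"
            unfolding of_nat_mult mult.assoc by (rule mult_left_mono) simp
        qed
        finally show ?thesis .
      qed
      then show "\<exists>B. \<forall>k. \<forall>\<xi>\<in>rays (tree N \<omega>). visits ?V \<xi> (int k) \<le> ennreal (B * (real k + 1) ^ Suc p)"
        by blast
    qed
  qed
qed

end

section \<open>Growth of the number of visits\<close>

lemma ln_ennreal_eq_0_iff: "ln_ennreal a = 0 \<longleftrightarrow> a = 1"
proof (cases a rule: ennreal_cases)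
  case (real r)
  then show ?thesis by (cases "r = 0") (auto simp: ln_ennreal_def ln_eq_zero_iff)
qed (simp add: ln_ennreal_def)

lemma enn2ereal_diff_eq_0_iff:
  assumes "a < \<infinity> \<or> b < \<infinity>"
  shows "enn2ereal a - enn2ereal b = 0 \<longleftrightarrow> a = b"
  using assms by (cases a rule: ennreal_cases; cases b rule: ennreal_cases) (auto simp: enn2ereal_ennreal zero_ereal_def)

text \<open>
  The conditions on \<open>\<mu>\<close> at \<open>t\<close> are conditions on the moments of the law \<open>e\<^sup>-\<^sup>t\<^sup>x \<mu>(dx)\<close>. For a real number
  \<open>y\<close>, \<open>ennreal y\<close> and \<open>ennreal (- y)\<close> are its positive and negative parts.
\<close>

lemma nn_integral_tilted:
  fixes \<mu> :: "real measure"
  assumes [simp, measurable_cong]: "sets \<mu> = sets borel"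
  defines "\<nu> \<equiv> \<lambda>t. density \<mu> (\<lambda>x. ennreal (exp (- t * x)))"
  shows "tilted_pos \<mu> t = (\<integral>\<^sup>+y. ennreal y \<partial>\<nu> t)"
    and "tilted_neg \<mu> t = (\<integral>\<^sup>+y. ennreal (- y) \<partial>\<nu> t)"
    and "(\<integral>\<^sup>+x. ennreal (x\<^sup>2 * exp (- t * x)) \<partial>\<mu>) = (\<integral>\<^sup>+y. ennreal (y\<^sup>2) \<partial>\<nu> t)"
    and "log_laplace \<mu> t = 0 \<Longrightarrow> (\<integral>\<^sup>+x. ennreal (exp (- t * x)) \<partial>\<mu>) = 1"
    and "log_laplace \<mu> t = 0 \<Longrightarrow> real_law (\<nu> t)"
proof -
  have \<nu>: "(\<integral>\<^sup>+y. ennreal (f y) \<partial>\<nu> t) = (\<integral>\<^sup>+y. ennreal (exp (- t * y)) * ennreal (f y) \<partial>\<mu>)"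
    if "f \<in> borel_measurable borel" for f
    unfolding \<nu>_def using that by (intro nn_integral_density) simp_all
  show "tilted_pos \<mu> t = (\<integral>\<^sup>+y. ennreal y \<partial>\<nu> t)"
    unfolding tilted_pos_def by (subst \<nu>)
      (auto intro!: nn_integral_cong simp: indicator_def ennreal_mult mult.commute ennreal_neg)
  show "tilted_neg \<mu> t = (\<integral>\<^sup>+y. ennreal (- y) \<partial>\<nu> t)"
    unfolding tilted_neg_def by (subst \<nu>)
      (auto intro!: nn_integral_cong simp: indicator_def ennreal_mult mult.commute ennreal_neg abs_if)
  show "(\<integral>\<^sup>+x. ennreal (x\<^sup>2 * exp (- t * x)) \<partial>\<mu>) = (\<integral>\<^sup>+y. ennreal (y\<^sup>2) \<partial>\<nu> t)"
    by (subst \<nu>) (auto intro!: nn_integral_cong simp: ennreal_mult mult.commute)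
  show total: "(\<integral>\<^sup>+x. ennreal (exp (- t * x)) \<partial>\<mu>) = 1" if "log_laplace \<mu> t = 0"
    using that by (simp add: log_laplace_def ln_ennreal_eq_0_iff)
  show "real_law (\<nu> t)" if "log_laplace \<mu> t = 0"
  proof (intro real_law.intro prob_spaceI real_law_axioms.intro)
    show "emeasure (\<nu> t) (space (\<nu> t)) = 1"
      unfolding \<nu>_def using total[OF that] sets_eq_imp_space_eq[OF assms(1)]
      by (simp add: emeasure_density)
  qed (simp add: \<nu>_def)
qed

context branching_random_walk
begin

lemma AE_polynomial_visits_H1:
  assumes "H1 \<mu>"
  shows "AE \<omega> in M. \<exists>B. \<forall>k. \<forall>\<xi>\<in>rays (tree N \<omega>).
    visits (position X \<omega>) \<xi> (int k) \<le> ennreal (B * (real k + 1) ^ 1)"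
proof -
  from assms obtain t where t: "0 < t" "log_laplace \<mu> t = 0"
    and mean: "mean_well_defined \<mu> t" "tilted_mean \<mu> t \<noteq> 0"
    unfolding H1_def by blast
  interpret tilted: real_law "density \<mu> (\<lambda>x. ennreal (exp (- t * x)))"
    by (rule nn_integral_tilted(5)) (use t in auto)
  have "tilted_pos \<mu> t \<noteq> tilted_neg \<mu> t"
    using mean unfolding mean_well_defined_def tilted_mean_def
    by (subst (asm) enn2ereal_diff_eq_0_iff) auto
  then obtain \<delta> d where *: "0 < \<delta>" "\<delta> \<le> 1" "0 < d" "d \<le> 1"
    and esc: "\<And>b. \<exists>H. escape_function (density \<mu> (\<lambda>x. ennreal (exp (- t * x)))) UNIV {b..b + \<delta>} d H"
    using tilted.escape_function_drift by (metis nn_integral_tilted(1,2) sets_intensity)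
  show ?thesis
    using AE_polynomial_visits[OF t(1) *, of UNIV 0] esc by simp
qed

text \<open>
  The escape functions exist for paths above any fixed barrier \<open>- K\<close>, with a rate of order \<open>1 / (k + K)\<close>.
  The resulting bounds hold almost surely for all integers \<open>K\<close> simultaneously, and the random barrier of
  \<open>AE_bounded_below\<close> selects one of them.
\<close>

lemma AE_polynomial_visits_H2:
  assumes "H2 \<mu>"
  shows "AE \<omega> in M. \<exists>B. \<forall>k. \<forall>\<xi>\<in>rays (tree N \<omega>).
    visits (position X \<omega>) \<xi> (int k) \<le> ennreal (B * (real k + 1) ^ 2)"
proof -
  from assms obtain t where t: "0 < t" "log_laplace \<mu> t = 0"
    and mean: "mean_well_defined \<mu> t" "tilted_mean \<mu> t = 0"
    and var: "0 < (\<integral>\<^sup>+ x. ennreal (x\<^sup>2 * exp (- t * x)) \<partial>\<mu>)"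
       "(\<integral>\<^sup>+ x. ennreal (x\<^sup>2 * exp (- t * x)) \<partial>\<mu>) < \<infinity>"
    unfolding H2_def by blast
  let ?\<nu> = "density \<mu> (\<lambda>x. ennreal (exp (- t * x)))"
  note tilted = nn_integral_tilted[OF sets_intensity, where t = t]
  interpret tilted: real_law ?\<nu>
    by (rule tilted(5)) (use t in auto)
  have eq: "tilted_pos \<mu> t = tilted_neg \<mu> t"
    using mean unfolding mean_well_defined_def tilted_mean_def
    by (subst (asm) enn2ereal_diff_eq_0_iff) auto
  then have fin: "tilted_pos \<mu> t < \<infinity>" using mean(1) by (auto simp: mean_well_defined_def)
  obtain \<delta> a c where \<delta>: "0 < \<delta>" "\<delta> \<le> 1" and a: "1 \<le> a" and c: "0 < c" "c \<le> 1"
    and esc: "\<And>K b. 0 \<le> K \<Longrightarrow> 0 \<le> b \<Longrightarrow> \<exists>H. escape_function ?\<nu> {- K..} {b..b + \<delta>} (c / (b + K + a)) H"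
    using tilted.escape_function_no_drift eq fin var unfolding tilted(1,2,3) by metis
  have "AE \<omega> in M. (\<forall>u\<in>tree N \<omega>. position X \<omega> u \<in> {- real K..}) \<longrightarrow>
    (\<exists>B. \<forall>k. \<forall>\<xi>\<in>rays (tree N \<omega>). visits (position X \<omega>) \<xi> (int k) \<le> ennreal (B * (real k + 1) ^ Suc 1))" for K :: nat
  proof (rule AE_polynomial_visits[OF t(1) \<delta>])
    let ?c = "c / (real K + a + 1)"
    show "0 < ?c" "?c \<le> 1" using c a by (auto simp: divide_le_eq)
    fix k :: nat and b :: real
    assume b: "real k \<le> b" "b \<le> real k + 1"
    obtain H where H: "escape_function ?\<nu> {- real K..} {b..b + \<delta>} (c / (b + real K + a)) H"
      using esc[of "real K" b] b by auto
    have "b + real K + a \<le> (real K + a + 1) * (real k + 1)"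
    proof -
      have "0 \<le> (real K + a) * real k" using a by simp
      then show ?thesis using b by (simp add: algebra_simps)
    qed
    then have "?c / (real k + 1) ^ 1 \<le> c / (b + real K + a)"
      using b a c by (simp add: frac_le)
    with escape_function_mono_rate[OF H]
    show "\<exists>H. escape_function ?\<nu> {- real K..} {b..b + \<delta>} (?c / (real k + 1) ^ 1) H" by blast
  qed simp
  then have "AE \<omega> in M. \<forall>K::nat. (\<forall>u\<in>tree N \<omega>. position X \<omega> u \<in> {- real K..}) \<longrightarrow>
    (\<exists>B. \<forall>k. \<forall>\<xi>\<in>rays (tree N \<omega>). visits (position X \<omega>) \<xi> (int k) \<le> ennreal (B * (real k + 1) ^ Suc 1))"
    by (subst AE_all_countable) blast
  moreover have "AE \<omega> in M. \<exists>K::nat. \<forall>u\<in>tree N \<omega>. - real K \<le> position X \<omega> u"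
    by (rule AE_bounded_below[OF t(1) tilted(4)[OF t(2)]])
  ultimately show ?thesis
    by eventually_elim (auto simp: numeral_2_eq_2)
qed

lemma AE_survival_visits_tendsto_0:
  fixes q :: nat
  assumes "AE \<omega> in M. \<exists>B. \<forall>k. \<forall>\<xi>\<in>rays (tree N \<omega>).
    visits (position X \<omega>) \<xi> (int k) \<le> ennreal (B * (real k + 1) ^ q)"
  shows "AE \<omega> in uniform_measure M (survival M N). \<forall>\<kappa>>real q.
    (\<lambda>n. ennreal (1 / real n powr \<kappa>) *
      (SUP \<xi>\<in>rays (tree N \<omega>). visits (position X \<omega>) \<xi> (int n))) \<longlonglongrightarrow> 0"
proof (rule AE_uniform_measureI[OF survival_in_sets])
  show "AE \<omega> in M. \<omega> \<in> survival M N \<longrightarrow> (\<forall>\<kappa>>real q.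
    (\<lambda>n. ennreal (1 / real n powr \<kappa>) *
      (SUP \<xi>\<in>rays (tree N \<omega>). visits (position X \<omega>) \<xi> (int n))) \<longlonglongrightarrow> 0)"
    using assms
  proof eventually_elim
    case (elim \<omega>)
    then obtain B where "visits (position X \<omega>) \<xi> (int k) \<le> ennreal (B * (real k + 1) ^ q)"
      if "\<xi> \<in> rays (tree N \<omega>)" for k \<xi> by blast
    then show ?case
      by (intro impI allI polynomial_bound_tendsto_0[where B = B and q = q] SUP_least) auto
  qed
qed

end

theorem theorem1p5:
  fixes M :: "'w measure"
    and N :: "label \<Rightarrow> 'w \<Rightarrow> enat"
    and X :: "label \<Rightarrow> nat \<Rightarrow> 'w \<Rightarrow> real"
    and \<mu> :: "real measure"
  assumes brw: "branching_random_walk M N X"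
    and mu: "\<mu> = intensity M (offspring N X [])"
    and supercritical: "emeasure \<mu> UNIV > 1"
  shows "(H1 \<mu> \<longrightarrow> (AE \<omega> in uniform_measure M (survival M N). \<forall>\<kappa>>1.
            (\<lambda>n. ennreal (1 / real n powr \<kappa>) *
               (SUP \<xi>\<in>rays (tree N \<omega>). visits (position X \<omega>) \<xi> (int n))) \<longlonglongrightarrow> 0)) \<and>
         (H2 \<mu> \<longrightarrow> (AE \<omega> in uniform_measure M (survival M N). \<forall>\<kappa>>2.
            (\<lambda>n. ennreal (1 / real n powr \<kappa>) *
               (SUP \<xi>\<in>rays (tree N \<omega>). visits (position X \<omega>) \<xi> (int n))) \<longlonglongrightarrow> 0))"
proof -
  interpret branching_random_walk M N X by (rule brw)
  show ?thesis
    unfolding mu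
    using AE_survival_visits_tendsto_0[OF AE_polynomial_visits_H1]
      AE_survival_visits_tendsto_0[OF AE_polynomial_visits_H2]
    by simp
qed

end
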